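(* Let $n\ge1$, $k\in\mathbb Z^+$, and let $\mu$ be a partition with $\mu_1\le n$. Let $v_{\widetilde\mu}$ be a highest weight vector of the irreducible $gl(n)$-module $Schur_\mu(n)$ of highest weight $\widetilde\mu$. (1) $\mathbf{I}_k(n)(v_{\widetilde\mu})=h^*_k(\widetilde\mu)\cdot v_{\widetilde\mu}$ with $h^*_k(\widetilde\mu)\in\mathbb N$ given by $$h^*_k(\widetilde\mu)=\sum vstrip_\mu(k)!,$$ where the sum ranges over all vertical strips of length $k$ in the Ferrers diagram of $\mu$. (2) Therefore $\mathbf{I}_k(n)(v_{\widetilde\mu})=h^*_k(\widetilde\mu)\cdot v_{\widetilde\mu}$, $h^*_k(\widetilde\mu)\in\mathbb Z$, where $$h^*_k(\widetilde\mu)=\sum_{1\le i_1\le i_2\le\cdots\le i_k\le n}(\widetilde\mu_{i_1}-k+1)(\widetilde\mu_{i_2}-k+2)\cdots(\widetilde\mu_{i_k}).$$ (3) If $\widetilde\mu_1<k$, then $\mathbf{I}_k(n)(v_{\widetilde\mu})=0$.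
   Context: Virtual method. $gl(m_0|m_1+n)$ ($m_0,m_1$ sufficiently large) is the complex general linear Lie superalgebra with basis $e_{a,b}$, $a,b\in A_0\cup A_1\cup L$, $A_0=\{\alpha_1,\dots,\alpha_{m_0}\}$ (parity $0$), $A_1=\{\beta_1,\dots,\beta_{m_1}\}$ (parity $1$), $L=\{1,\dots,n\}$ (parity $1$), $|e_{a,b}|=|a|+|b|$, and $[e_{a,b},e_{c,d}]=\delta_{bc}e_{a,d}-(-1)^{(|a|+|b|)(|c|+|d|)}\delta_{ad}e_{c,b}$. Symbols in $A_0\cup A_1$ are virtual. $gl(n)$ is the subalgebra spanned by $e_{i,j}$, $i,j\in L$, so $\mathbf{U}(gl(n))\subset\mathbf{U}(gl(m_0|m_1+n))$. A product $e_{a_M,b_M}\cdots e_{a_1,b_1}$ is irregular if there are $i\le M$ and a virtual symbol $\gamma$ with $\#\{j\le i: b_j=\gamma\}>\#\{j<i: a_j=\gamma\}$. Let $\mathbf{Irr}$ be the left ideal of $\mathbf{U}(gl(m_0|m_1+n))$ generated by irregular products. The sum $Virt(m_0+m_1,n)=\mathbf{U}(gl(n))\oplus\mathbf{Irr}$ is direct and is a subalgebra in which $\mathbf{Irr}$ is a two-sided ideal; $\mathfrak p:Virt(m_0+m_1,n)\to\mathbf{U}(gl(n))$ is the projection with kernel $\mathbf{Irr}$ (an algebra epimorphism). All monomials to which $\mathfrak p$ is applied here lie in $Virt(m_0+m_1,n)$. For $k\in\mathbb Z^+$ and any $\beta\in A_1$, $$\mathbf{I}_k(n)=\sum_{h_1+\cdots+h_n=k}\frac1{h_1!\cdots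 h_n!}\,\mathfrak p\big(e_{n,\beta}^{h_n}\cdots e_{1,\beta}^{h_1}e_{\beta,1}^{h_1}\cdots e_{\beta,n}^{h_n}\big)\in\mathbf{U}(gl(n)),$$ which is a central element. For a partition $\mu$ with $\mu_1\le n$, $Schur_\mu(n)$ is the irreducible $gl(n)$-module of highest weight $\widetilde\mu$ (conjugate partition, padded by zeros to length $n$). A vertical strip of length $k$ (generalized sense) in the Ferrers diagram of $\mu$ (rows of lengths $\mu_1\ge\mu_2\ge\cdots$) is a set of $k$ cells no two of which lie in the same row; a vertical component is the set of all cells of the strip lying in one given column, and $vstrip_\mu(k)!$ is the product of the factorials of the cardinalities of the vertical components. *)

theory Defs
  imports
    "HOL-Algebra.QuotRing"
    "HOL-Library.Poly_Mapping"
    "HOL-Library.FuncSet"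
    Complex_Main
begin

section \<open>Enveloping algebras of general linear Lie superalgebras\<close>

text \<open>
  The index symbols: \<^term>\<open>Alpha s\<close> and \<^term>\<open>Beta t\<close> are the virtual symbols
  $\alpha_s$ and $\beta_t$, and \<^term>\<open>Proper i\<close> is the symbol $i$ of $L$.
\<close>

datatype symbol = Alpha (idx: nat) | Beta (idx: nat) | Proper (idx: nat)

fun parity :: "symbol \<Rightarrow> nat" where
  "parity (Alpha s) = 0"
| "parity (Beta t) = 1"
| "parity (Proper i) = 1"

definition sym_A0 :: "nat \<Rightarrow> symbol set" where "sym_A0 m0 = Alpha ` {1..m0}"
definition sym_A1 :: "nat \<Rightarrow> symbol set" where "sym_A1 m1 = Beta ` {1..m1}"
definition sym_L :: "nat \<Rightarrow> symbol set" where "sym_L n = Proper ` {1..n}"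

definition symbols :: "nat \<Rightarrow> nat \<Rightarrow> nat \<Rightarrow> symbol set" where
  "symbols m0 m1 n = sym_A0 m0 \<union> sym_A1 m1 \<union> sym_L n"

text \<open>
  Words form a monoid under concatenation, so finitely supported functions on words, with the
  convolution product of \<^theory>\<open>HOL-Library.Poly_Mapping\<close>, form the free associative algebra.
\<close>

instantiation list :: (type) monoid_add
begin
definition zero_list :: "'a list" where "zero_list = []"
definition plus_list :: "'a list \<Rightarrow> 'a list \<Rightarrow> 'a list" where "plus_list = (@)"
instance by standard (simp_all add: zero_list_def plus_list_def)
end

type_synonym letter = "symbol \<times> symbol"
type_synonym tensor = "letter list \<Rightarrow>\<^sub>0 complex"

text \<open>
  The tensor algebra of the Lie superalgebra with basis $e_{a,b}$, $a, b \in S$: the free algebra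
  on the basis, the pair $(a,b)$ standing for $e_{a,b}$.
\<close>

definition tensor_alg :: "symbol set \<Rightarrow> tensor ring" where
  "tensor_alg S =
    \<lparr>carrier = {x. \<forall>w\<in>Poly_Mapping.keys x. set w \<subseteq> S \<times> S},
     mult = (*), one = 1, zero = 0, add = (+)\<rparr>"

definition gen :: "symbol \<Rightarrow> symbol \<Rightarrow> tensor" where
  "gen a b = Poly_Mapping.single [(a, b)] 1"

definition delta :: "symbol \<Rightarrow> symbol \<Rightarrow> tensor" where
  "delta a b = (if a = b then 1 else 0)"

definition koszul_sign :: "symbol \<Rightarrow> symbol \<Rightarrow> symbol \<Rightarrow> symbol \<Rightarrow> tensor" where
  "koszul_sign a b c d = (- 1) ^ ((parity a + parity b) * (parity c + parity d))"

definition gl_bracket :: "symbol \<Rightarrow> symbol \<Rightarrow> symbol \<Rightarrow> symbol \<Rightarrow> tensor" where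
  "gl_bracket a b c d = delta b c * gen a d - koszul_sign a b c d * delta a d * gen c b"

definition enveloping_ideal :: "symbol set \<Rightarrow> tensor set" where
  "enveloping_ideal S = Idl\<^bsub>tensor_alg S\<^esub>
    {gen a b * gen c d - koszul_sign a b c d * (gen c d * gen a b) - gl_bracket a b c d | a b c d.
      a \<in> S \<and> b \<in> S \<and> c \<in> S \<and> d \<in> S}"

text \<open>
  The enveloping algebra of the Lie superalgebra spanned by the $e_{a,b}$ with $a, b \in S$. For
  \<^term>\<open>S = symbols m0 m1 n\<close> this is $\mathbf{U}(gl(m_0|m_1+n))$; for \<^term>\<open>S = sym_L n\<close> all
  $e_{i,j}$ are even, and it is $\mathbf{U}(gl(n))$.
\<close>

definition UEA :: "symbol set \<Rightarrow> tensor set ring" where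
  "UEA S = tensor_alg S Quot enveloping_ideal S"

abbreviation cls :: "symbol set \<Rightarrow> tensor \<Rightarrow> tensor set" where
  "cls S x \<equiv> enveloping_ideal S +>\<^bsub>tensor_alg S\<^esub> x"

definition scalar_mult :: "symbol set \<Rightarrow> complex \<Rightarrow> tensor set \<Rightarrow> tensor set" where
  "scalar_mult S c u = cls S (Poly_Mapping.single 0 c) \<otimes>\<^bsub>UEA S\<^esub> u"

text \<open>The product in \<^term>\<open>UEA S\<close> of the $e_{a,b}$ listed in a word, from left to right.\<close>

definition monomial :: "symbol set \<Rightarrow> letter list \<Rightarrow> tensor set" where
  "monomial S w = foldr (\<lambda>(a, b) u. cls S (gen a b) \<otimes>\<^bsub>UEA S\<^esub> u) w \<one>\<^bsub>UEA S\<^esub>"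


section \<open>The virtual method\<close>

text \<open>
  The factors of a product $e_{a_M,b_M} \cdots e_{a_1,b_1}$ are numbered from the right; the
  $j$-th factor of a word \<^term>\<open>w\<close> is therefore \<^term>\<open>rev w ! (j - 1)\<close>.
\<close>

definition irregular :: "nat \<Rightarrow> nat \<Rightarrow> letter list \<Rightarrow> bool" where
  "irregular m0 m1 w \<longleftrightarrow>
    (\<exists>i\<in>{1..length w}. \<exists>\<gamma>\<in>sym_A0 m0 \<union> sym_A1 m1.
      card {j\<in>{1..i}. snd (rev w ! (j - 1)) = \<gamma>}
        > card {j\<in>{1..<i}. fst (rev w ! (j - 1)) = \<gamma>})"

definition left_ideal :: "'a set \<Rightarrow> ('a, 'b) ring_scheme \<Rightarrow> bool" where
  "left_ideal I R \<longleftrightarrow> additive_subgroup I R \<and> (\<forall>r\<in>carrier R. \<forall>x\<in>I. r \<otimes>\<^bsub>R\<^esub> x \<in> I)"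

definition left_ideal_generated :: "('a, 'b) ring_scheme \<Rightarrow> 'a set \<Rightarrow> 'a set" where
  "left_ideal_generated R G = \<Inter> {I. left_ideal I R \<and> G \<subseteq> I}"

definition Irr :: "nat \<Rightarrow> nat \<Rightarrow> nat \<Rightarrow> tensor set set" where
  "Irr m0 m1 n = left_ideal_generated (UEA (symbols m0 m1 n))
    {monomial (symbols m0 m1 n) w | w.
      set w \<subseteq> symbols m0 m1 n \<times> symbols m0 m1 n \<and> irregular m0 m1 w}"

text \<open>
  The canonical map $\mathbf{U}(gl(n)) \to \mathbf{U}(gl(m_0|m_1+n))$:
  the classes in the larger algebra of the representatives of \<^term>\<open>u\<close> all coincide.
\<close>

definition inclusion :: "nat \<Rightarrow> nat \<Rightarrow> nat \<Rightarrow> tensor set \<Rightarrow> tensor set" where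
  "inclusion m0 m1 n u = the_elem (cls (symbols m0 m1 n) ` u)"

text \<open>
  The projection of $Virt(m_0+m_1,n) = \mathbf{U}(gl(n)) \oplus \mathbf{Irr}$ onto
  $\mathbf{U}(gl(n))$ along $\mathbf{Irr}$. The sum is direct and the inclusion is injective, so
  the element chosen is the only one with this property; the value is meaningful only for
  \<^term>\<open>x\<close> in $Virt(m_0+m_1,n)$.
\<close>

definition virtual_proj :: "nat \<Rightarrow> nat \<Rightarrow> nat \<Rightarrow> tensor set \<Rightarrow> tensor set" where
  "virtual_proj m0 m1 n x =
    (SOME u. u \<in> carrier (UEA (sym_L n)) \<and>
      (\<exists>y\<in>Irr m0 m1 n. x = inclusion m0 m1 n u \<oplus>\<^bsub>UEA (symbols m0 m1 n)\<^esub> y))"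

text \<open>
  The word of
  $e_{n,\beta}^{h_n} \cdots e_{1,\beta}^{h_1} e_{\beta,1}^{h_1} \cdots e_{\beta,n}^{h_n}$.
\<close>

definition I_word :: "nat \<Rightarrow> symbol \<Rightarrow> (nat \<Rightarrow> nat) \<Rightarrow> letter list" where
  "I_word n \<beta> h =
    concat (map (\<lambda>i. replicate (h i) (Proper i, \<beta>)) (rev [1..<Suc n])) @
    concat (map (\<lambda>i. replicate (h i) (\<beta>, Proper i)) [1..<Suc n])"

definition I_elem :: "nat \<Rightarrow> nat \<Rightarrow> nat \<Rightarrow> symbol \<Rightarrow> nat \<Rightarrow> tensor set" where
  "I_elem m0 m1 n \<beta> k =
    (\<Oplus>\<^bsub>UEA (sym_L n)\<^esub>h\<in>{h \<in> {1..n} \<rightarrow>\<^sub>E (UNIV :: nat set). (\<Sum>i=1..n. h i) = k}.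
      scalar_mult (sym_L n) (1 / (\<Prod>i=1..n. fact (h i)))
        (virtual_proj m0 m1 n (monomial (symbols m0 m1 n) (I_word n \<beta> h))))"


section \<open>Modules over $gl(n)$\<close>

text \<open>A $gl(n)$-module on the whole type \<^typ>\<open>'v\<close>; \<^term>\<open>\<rho> i j\<close> is the action of $e_{i,j}$.\<close>

locale gl_module = vector_space smul
  for n :: nat
    and smul :: "complex \<Rightarrow> 'v::ab_group_add \<Rightarrow> 'v"
    and \<rho> :: "nat \<Rightarrow> nat \<Rightarrow> 'v \<Rightarrow> 'v" +
  assumes rho_linear:
      "i \<in> {1..n} \<Longrightarrow> j \<in> {1..n} \<Longrightarrow> Vector_Spaces.linear smul smul (\<rho> i j)"
    and rho_bracket:
      "i \<in> {1..n} \<Longrightarrow> j \<in> {1..n} \<Longrightarrow> k \<in> {1..n} \<Longrightarrow> l \<in> {1..n} \<Longrightarrow>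
        \<rho> i j (\<rho> k l v) - \<rho> k l (\<rho> i j v) =
          (if j = k then \<rho> i l v else 0) - (if i = l then \<rho> k j v else 0)"

locale irreducible_gl_module = gl_module n smul \<rho>
  for n :: nat
    and smul :: "complex \<Rightarrow> 'v::ab_group_add \<Rightarrow> 'v"
    and \<rho> :: "nat \<Rightarrow> nat \<Rightarrow> 'v \<Rightarrow> 'v" +
  assumes nonzero: "\<exists>v::'v. v \<noteq> 0"
    and irreducible:
      "subspace W \<Longrightarrow> (\<And>i j w. i \<in> {1..n} \<Longrightarrow> j \<in> {1..n} \<Longrightarrow> w \<in> W \<Longrightarrow> \<rho> i j w \<in> W) \<Longrightarrow>
        W = {0} \<or> W = UNIV"

definition highest_weight_vector ::
  "nat \<Rightarrow> (complex \<Rightarrow> 'v::ab_group_add \<Rightarrow> 'v) \<Rightarrow> (nat \<Rightarrow> nat \<Rightarrow> 'v \<Rightarrow> 'v) \<Rightarrow>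
    (nat \<Rightarrow> complex) \<Rightarrow> 'v \<Rightarrow> bool" where
  "highest_weight_vector n smul \<rho> wt v \<longleftrightarrow>
    v \<noteq> 0 \<and>
    (\<forall>i\<in>{1..n}. \<forall>j\<in>{1..n}. i < j \<longrightarrow> \<rho> i j v = 0) \<and>
    (\<forall>i\<in>{1..n}. \<rho> i i v = smul (wt i) v)"

text \<open>
  The action of $\mathbf{U}(gl(n))$ on a $gl(n)$-module: first of tensors, then of their classes
  (on each of which the value is constant).
\<close>

definition tensor_action ::
  "(complex \<Rightarrow> 'v::ab_group_add \<Rightarrow> 'v) \<Rightarrow> (nat \<Rightarrow> nat \<Rightarrow> 'v \<Rightarrow> 'v) \<Rightarrow> tensor \<Rightarrow> 'v \<Rightarrow> 'v" where
  "tensor_action smul \<rho> x v =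
    (\<Sum>w\<in>Poly_Mapping.keys x.
      smul (Poly_Mapping.lookup x w) (foldr (\<lambda>(a, b). \<rho> (idx a) (idx b)) w v))"

definition U_action ::
  "(complex \<Rightarrow> 'v::ab_group_add \<Rightarrow> 'v) \<Rightarrow> (nat \<Rightarrow> nat \<Rightarrow> 'v \<Rightarrow> 'v) \<Rightarrow> tensor set \<Rightarrow> 'v \<Rightarrow> 'v" where
  "U_action smul \<rho> u v = the_elem ((\<lambda>x. tensor_action smul \<rho> x v) ` u)"


section \<open>Partitions and vertical strips\<close>

definition is_partition :: "nat list \<Rightarrow> bool" where
  "is_partition \<mu> \<longleftrightarrow> sorted_wrt (\<ge>) \<mu> \<and> (\<forall>x\<in>set \<mu>. 0 < x)"

definition part :: "nat list \<Rightarrow> nat \<Rightarrow> nat" where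
  "part \<mu> i = (if i \<in> {1..length \<mu>} then \<mu> ! (i - 1) else 0)"

text \<open>Cells are pairs (row, column), counted from 1.\<close>

definition ferrers :: "nat list \<Rightarrow> (nat \<times> nat) set" where
  "ferrers \<mu> = {(r, c). 1 \<le> r \<and> r \<le> length \<mu> \<and> 1 \<le> c \<and> c \<le> part \<mu> r}"

definition conjugate :: "nat list \<Rightarrow> nat \<Rightarrow> nat" where
  "conjugate \<mu> c = card {r \<in> {1..length \<mu>}. c \<le> part \<mu> r}"

definition vertical_strips :: "nat list \<Rightarrow> nat \<Rightarrow> (nat \<times> nat) set set" where
  "vertical_strips \<mu> k = {V. V \<subseteq> ferrers \<mu> \<and> card V = k \<and> inj_on fst V}"

definition vstrip_fact :: "(nat \<times> nat) set \<Rightarrow> nat" where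
  "vstrip_fact V = (\<Prod>c\<in>snd ` V. fact (card {p \<in> V. snd p = c}))"

definition hstar :: "nat list \<Rightarrow> nat \<Rightarrow> nat" where
  "hstar \<mu> k = (\<Sum>V\<in>vertical_strips \<mu> k. vstrip_fact V)"

end

theory Submission
  imports
    Defs
    "HOL-Library.Function_Algebras"
    "HOL-Library.Product_Plus"
    "HOL-Library.Nat_Bijection"
begin

text \<open>
  A vector $v$ of a $gl(m_0|m_1+n)$-module that is annihilated by all $e_{a,\gamma}$ with
  $\gamma$ virtual is annihilated by $\mathbf{Irr}$, so $\mathfrak p(x) v = x v$ for
  $x \in Virt(m_0+m_1,n)$. If moreover $v$ is a highest weight vector for $gl(n)$, then
  $e_{c,\beta}$ kills $e_{\beta,c+1}^{h_{c+1}} \cdots e_{\beta,n}^{h_n} v$, and the $sl_2$-identity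
  for $e_{c,\beta}$ and $e_{\beta,c}$, applied from the inner column outwards, gives the eigenvalue
  of the monomial with exponents $h$ as
  $\prod_c h_c! \, (\widetilde\mu_c - h_{c+1} - \cdots - h_n)^{\underline{h_c}}$.

  Such a $v$ of weight $\widetilde\mu$ exists in the Fock space generated by variables $x_{a,s}$,
  $1 \le s \le \ell(\mu)$, of parity $|a|$, on which $e_{a,b}$ acts as
  $\sum_s x_{a,s} \partial_{b,s}$: it is the monomial of all $x_{i,s}$ with
  $s \le \widetilde\mu_i$. The eigenvalue on this $v$ is the one on the highest weight vector of the
  irreducible module, since the latter is a quotient of the submodule generated by $v$.
\<close>

section \<open>Tensors and their classes\<close>

text \<open>Two obstacles shape the proof. The projection is a choice, known only through the
  equation that defines it, and the given irreducible module carries no action of the virtual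
  symbols. So the computation takes place in an explicit module of the large superalgebra, and only
  the resulting annihilation statement is carried over. That irregular products kill the vacuum is
  not immediate, since the offending factor may stand far to the left. The argument counts virtual
  symbols: everything generated from the vacuum has nonnegative weight for each virtual $\<gamma>$,
  and an irregular product either passes through a negative weight or applies
  $e_{\<gamma>,\<gamma>}$ to a vector of weight 0. The combinatorial half compares three sums: over
  strips, over exponent vectors, over increasing sequences. All obey one recursion over columns:
  column c takes h of the k units, the later columns take k - h, and the factor is the falling
  factorial of length h of $\<mu>'_c - (k - h)$, where $\<mu>'$ is the conjugate partition.\<close>

definition tensors :: "symbol set \<Rightarrow> tensor set" where
  "tensors S = {x. \<forall>w\<in>Poly_Mapping.keys x. set w \<subseteq> S \<times> S}"

lemma tensor_alg_simps [simp]: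
  "carrier (tensor_alg S) = tensors S"
  "x \<otimes>\<^bsub>tensor_alg S\<^esub> y = x * y"
  "x \<oplus>\<^bsub>tensor_alg S\<^esub> y = x + y"
  "\<one>\<^bsub>tensor_alg S\<^esub> = 1"
  "\<zero>\<^bsub>tensor_alg S\<^esub> = 0"
  by (simp_all add: tensor_alg_def tensors_def)

abbreviation const :: "complex \<Rightarrow> tensor" where
  "const c \<equiv> Poly_Mapping.single 0 c"

definition word :: "letter list \<Rightarrow> tensor" where
  "word w = Poly_Mapping.single w 1"

lemma tensors_zero [simp, intro]: "0 \<in> tensors S"
  and tensors_one [simp, intro]: "1 \<in> tensors S"
  by (simp_all add: tensors_def zero_list_def)

lemma tensors_single: "set w \<subseteq> S \<times> S \<Longrightarrow> Poly_Mapping.single w c \<in> tensors S"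
  by (simp add: tensors_def)

lemma tensors_const [simp, intro]: "const c \<in> tensors S"
  by (simp add: tensors_single zero_list_def)

lemma tensors_word [intro]: "set w \<subseteq> S \<times> S \<Longrightarrow> word w \<in> tensors S"
  by (simp add: tensors_single word_def)

lemma tensors_gen [intro]: "a \<in> S \<Longrightarrow> b \<in> S \<Longrightarrow> gen a b \<in> tensors S"
  by (simp add: tensors_single gen_def)

lemma tensors_add [intro]: "x \<in> tensors S \<Longrightarrow> y \<in> tensors S \<Longrightarrow> x + y \<in> tensors S"
  using Poly_Mapping.keys_add[of x y] by (auto simp: tensors_def)

lemma tensors_uminus [intro]: "x \<in> tensors S \<Longrightarrow> - x \<in> tensors S"
  by (simp add: tensors_def)

lemma tensors_diff [intro]: "x \<in> tensors S \<Longrightarrow> y \<in> tensors S \<Longrightarrow> x - y \<in> tensors S"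
  using tensors_add[of x S "- y"] by auto

lemma tensors_mult [intro]: "x \<in> tensors S \<Longrightarrow> y \<in> tensors S \<Longrightarrow> x * y \<in> tensors S"
  using keys_mult[of x y] by (fastforce simp: tensors_def plus_list_def)

lemma tensors_sum [intro]: "(\<And>i. i \<in> A \<Longrightarrow> f i \<in> tensors S) \<Longrightarrow> sum f A \<in> tensors S"
  by (induction A rule: infinite_finite_induct) auto

lemma tensors_mono: "S \<subseteq> T \<Longrightarrow> tensors S \<subseteq> tensors T"
  by (fastforce simp: tensors_def)

lemma ring_tensor_alg: "ring (tensor_alg S)"
proof (rule ringI)
  show "abelian_group (tensor_alg S)"
  proof (rule abelian_groupI)
    fix x assume "x \<in> carrier (tensor_alg S)"
    then show "\<exists>y\<in>carrier (tensor_alg S). y \<oplus>\<^bsub>tensor_alg S\<^esub> x = \<zero>\<^bsub>tensor_alg S\<^esub>"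
      by (intro bexI[of _ "- x"]) auto
  qed (auto simp: add.assoc add.commute)
  show "monoid (tensor_alg S)"
    by (rule monoidI) (auto simp: mult.assoc)
qed (auto simp: distrib_left distrib_right)

lemma tensor_alg_a_inv: "x \<in> tensors S \<Longrightarrow> \<ominus>\<^bsub>tensor_alg S\<^esub> x = - x"
proof -
  interpret ring "tensor_alg S" by (rule ring_tensor_alg)
  show "x \<in> tensors S \<Longrightarrow> \<ominus>\<^bsub>tensor_alg S\<^esub> x = - x"
    by (rule minus_equality) auto
qed

lemma ideal_tensor_algI:
  assumes "I \<subseteq> tensors S" "0 \<in> I"
    and "\<And>x y. x \<in> I \<Longrightarrow> y \<in> I \<Longrightarrow> x + y \<in> I"
    and "\<And>x y. x \<in> I \<Longrightarrow> y \<in> tensors S \<Longrightarrow> y * x \<in> I"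
    and "\<And>x y. x \<in> I \<Longrightarrow> y \<in> tensors S \<Longrightarrow> x * y \<in> I"
  shows "ideal I (tensor_alg S)"
proof (rule idealI[OF ring_tensor_alg])
  interpret ring "tensor_alg S" by (rule ring_tensor_alg)
  have "- x \<in> I" if "x \<in> I" for x
    using assms(4)[of x "- 1"] that by auto
  then show "subgroup I (add_monoid (tensor_alg S))"
    using assms tensor_alg_a_inv by (intro add.subgroupI) auto
qed (use assms in auto)

lemma word_Nil [simp]: "word [] = 1"
  by (simp add: word_def flip: zero_list_def)

lemma word_Cons: "word ((a, b) # w) = gen a b * word w"
  by (simp add: word_def gen_def mult_single plus_list_def)

lemma gen_eq_word: "gen a b = word [(a, b)]"
  by (simp add: word_def gen_def)

lemma tensor_induct [consumes 1, case_names zero single add]: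
  assumes x: "x \<in> tensors S"
    and "P 0"
    and single: "\<And>w c. set w \<subseteq> S \<times> S \<Longrightarrow> P (Poly_Mapping.single w c)"
    and add: "\<And>x y. x \<in> tensors S \<Longrightarrow> y \<in> tensors S \<Longrightarrow> P x \<Longrightarrow> P y \<Longrightarrow> P (x + y)"
  shows "P x"
proof -
  have x_eq: "x = (\<Sum>w\<in>Poly_Mapping.keys x. Poly_Mapping.single w (Poly_Mapping.lookup x w))"
    by (rule poly_mapping_eqI)
      (simp add: lookup_sum lookup_single when_def in_keys_iff sum.delta)
  have "P (\<Sum>w\<in>K. Poly_Mapping.single w (Poly_Mapping.lookup x w)) \<and>
      (\<Sum>w\<in>K. Poly_Mapping.single w (Poly_Mapping.lookup x w)) \<in> tensors S"
    if "finite K" "K \<subseteq> Poly_Mapping.keys x" for K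
    using that
  proof (induction K rule: finite_induct)
    case (insert w K)
    moreover have "set w \<subseteq> S \<times> S"
      using x insert.prems by (auto simp: tensors_def)
    ultimately show ?case
      by (simp add: add single tensors_add tensors_single)
  qed (simp add: \<open>P 0\<close>)
  from this[of "Poly_Mapping.keys x"] show ?thesis
    using x_eq by simp
qed

text \<open>Here \<open>0\<close> is the empty word, so \<open>const c\<close> is c times the unit:
  scalars sit centrally in the free algebra.\<close>

lemma const_commute: "const c * x = x * const c"
proof -
  have "x \<in> tensors UNIV" by (simp add: tensors_def)
  then show ?thesis
    by (induction rule: tensor_induct) (auto simp: mult_single algebra_simps)
qed

lemma const_mult: "const (c * d) = const c * const d"
  by (simp add: mult_single)

lemma const_uminus_one: "(- 1) ^ n = const ((- 1) ^ n)"
  by (induction n) (auto simp: single_uminus const_mult simp del: mult_single)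

lemma delta_eq_const: "delta a b = const (if a = b then 1 else 0)"
  by (simp add: delta_def)

definition sgn_sym :: "symbol \<Rightarrow> symbol \<Rightarrow> symbol \<Rightarrow> symbol \<Rightarrow> complex" where
  "sgn_sym a b c d = (- 1) ^ ((parity a + parity b) * (parity c + parity d))"

lemma koszul_sign_eq_const: "koszul_sign a b c d = const (sgn_sym a b c d)"
  by (simp add: koszul_sign_def sgn_sym_def const_uminus_one)

section \<open>The defining relations and the ideal they generate\<close>

definition gl_rel :: "symbol \<Rightarrow> symbol \<Rightarrow> symbol \<Rightarrow> symbol \<Rightarrow> tensor" where
  "gl_rel a b c d =
    gen a b * gen c d - koszul_sign a b c d * (gen c d * gen a b) - gl_bracket a b c d"

text \<open>Writing every sign and delta as \<open>const\<close> makes both membership in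
  \<open>tensors\<close> and the action on a vector computable term by term.\<close>

lemma gl_rel_eq:
  "gl_rel a b c d = gen a b * gen c d - const (sgn_sym a b c d) * (gen c d * gen a b)
    - (const (if b = c then 1 else 0) * gen a d
       - const (sgn_sym a b c d * (if a = d then 1 else 0)) * gen c b)"
  by (simp add: gl_rel_def gl_bracket_def koszul_sign_eq_const delta_eq_const const_mult
      mult.assoc del: mult_single)

lemma enveloping_ideal_alt:
  "enveloping_ideal S = Idl\<^bsub>tensor_alg S\<^esub> {gl_rel a b c d | a b c d.
      a \<in> S \<and> b \<in> S \<and> c \<in> S \<and> d \<in> S}"
  by (simp add: enveloping_ideal_def gl_rel_def)

lemma gl_rel_tensors:
  "a \<in> S \<Longrightarrow> b \<in> S \<Longrightarrow> c \<in> S \<Longrightarrow> d \<in> S \<Longrightarrow> gl_rel a b c d \<in> tensors S"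
  unfolding gl_rel_eq by (intro tensors_diff tensors_mult tensors_gen tensors_const)

lemma ideal_enveloping_ideal: "ideal (enveloping_ideal S) (tensor_alg S)"
  unfolding enveloping_ideal_alt
  by (rule ring.genideal_ideal[OF ring_tensor_alg]) (auto simp: gl_rel_tensors)

lemma gl_rel_in_enveloping_ideal:
  "a \<in> S \<Longrightarrow> b \<in> S \<Longrightarrow> c \<in> S \<Longrightarrow> d \<in> S \<Longrightarrow> gl_rel a b c d \<in> enveloping_ideal S"
  unfolding enveloping_ideal_alt
  by (rule subsetD[OF ring.genideal_self[OF ring_tensor_alg]]) (auto simp: gl_rel_tensors)

lemma enveloping_ideal_minimal:
  assumes "ideal I (tensor_alg S)"
    and "\<And>a b c d. a \<in> S \<Longrightarrow> b \<in> S \<Longrightarrow> c \<in> S \<Longrightarrow> d \<in> S \<Longrightarrow> gl_rel a b c d \<in> I"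
  shows "enveloping_ideal S \<subseteq> I"
  unfolding enveloping_ideal_alt
  by (rule ring.genideal_minimal[OF ring_tensor_alg assms(1)]) (use assms(2) in auto)

lemma enveloping_ideal_subset: "enveloping_ideal S \<subseteq> tensors S"
  using ideal.Icarr[OF ideal_enveloping_ideal] by auto

lemma
  shows enveloping_ideal_zero: "0 \<in> enveloping_ideal S"
    and enveloping_ideal_add: "x \<in> enveloping_ideal S \<Longrightarrow> y \<in> enveloping_ideal S \<Longrightarrow>
      x + y \<in> enveloping_ideal S"
    and enveloping_ideal_mult_left: "x \<in> enveloping_ideal S \<Longrightarrow> y \<in> tensors S \<Longrightarrow>
      y * x \<in> enveloping_ideal S"
    and enveloping_ideal_mult_right: "x \<in> enveloping_ideal S \<Longrightarrow> y \<in> tensors S \<Longrightarrow>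
      x * y \<in> enveloping_ideal S"
proof -
  interpret ideal "enveloping_ideal S" "tensor_alg S" by (rule ideal_enveloping_ideal)
  show "0 \<in> enveloping_ideal S"
    using additive_subgroup.zero_closed[OF is_additive_subgroup] unfolding tensor_alg_simps .
  show "x + y \<in> enveloping_ideal S" if "x \<in> enveloping_ideal S" "y \<in> enveloping_ideal S"
    using additive_subgroup.a_closed[OF is_additive_subgroup that] unfolding tensor_alg_simps .
  show "y * x \<in> enveloping_ideal S" "x * y \<in> enveloping_ideal S"
    if "x \<in> enveloping_ideal S" "y \<in> tensors S"
    using I_l_closed[of x y] I_r_closed[of x y] that by simp_all
qed

text \<open>The part of the larger ideal inside \<open>tensors S\<close> is itself an ideal of
  \<open>tensor_alg S\<close> that contains the relations over \<open>S\<close>, so minimality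
  applies.\<close>

lemma enveloping_ideal_mono:
  assumes "S \<subseteq> T" shows "enveloping_ideal S \<subseteq> enveloping_ideal T"
proof -
  have "ideal (tensors S \<inter> enveloping_ideal T) (tensor_alg S)"
    using tensors_mono[OF assms]
    by (intro ideal_tensor_algI) (auto intro: enveloping_ideal_zero enveloping_ideal_add
        enveloping_ideal_mult_left enveloping_ideal_mult_right)
  then have "enveloping_ideal S \<subseteq> tensors S \<inter> enveloping_ideal T"
    using assms by (intro enveloping_ideal_minimal)
      (auto simp: gl_rel_tensors subset_iff intro!: gl_rel_in_enveloping_ideal)
  then show ?thesis by simp
qed

section \<open>Classes in the enveloping algebra\<close>

lemma cls_hom: "(\<lambda>x. cls S x) \<in> ring_hom (tensor_alg S) (UEA S)"
  unfolding UEA_def by (rule ideal.rcos_ring_hom[OF ideal_enveloping_ideal])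

lemma ring_UEA: "ring (UEA S)"
  unfolding UEA_def by (rule ideal.quotient_is_ring[OF ideal_enveloping_ideal])

lemma
  assumes "x \<in> tensors S"
  shows cls_carrier: "cls S x \<in> carrier (UEA S)"
    and cls_mult: "y \<in> tensors S \<Longrightarrow> cls S (x * y) = cls S x \<otimes>\<^bsub>UEA S\<^esub> cls S y"
    and cls_add: "y \<in> tensors S \<Longrightarrow> cls S (x + y) = cls S x \<oplus>\<^bsub>UEA S\<^esub> cls S y"
  using assms ring_hom_closed[OF cls_hom, of x S] ring_hom_mult[OF cls_hom, of x S y]
    ring_hom_add[OF cls_hom, of x S y]
  by simp_all

lemma cls_one: "\<one>\<^bsub>UEA S\<^esub> = cls S 1"
  using ring_hom_one[OF cls_hom[of S]] by simp

lemma carrier_UEA_E: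
  assumes "u \<in> carrier (UEA S)"
  obtains x where "x \<in> tensors S" "u = cls S x"
  using assms by (auto simp: UEA_def FactRing_def A_RCOSETS_def')

lemma cls_eq_iff:
  assumes "x \<in> tensors S" "y \<in> tensors S"
  shows "cls S x = cls S y \<longleftrightarrow> x - y \<in> enveloping_ideal S"
proof -
  interpret ring "tensor_alg S" by (rule ring_tensor_alg)
  have "x \<ominus>\<^bsub>tensor_alg S\<^esub> y = x - y"
    using assms by (simp add: a_minus_def tensor_alg_a_inv)
  then show ?thesis
    using quotient_eq_iff_same_a_r_cos[OF ideal_enveloping_ideal, of x y] assms by simp
qed

lemma cls_memD:
  assumes "y \<in> cls S x" "x \<in> tensors S"
  shows "y \<in> tensors S" "y - x \<in> enveloping_ideal S"
  using assms enveloping_ideal_subset[of S] by (auto simp: a_r_coset_def')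

lemma cls_self: "x \<in> tensors S \<Longrightarrow> x \<in> cls S x"
  using enveloping_ideal_zero[of S] by (auto simp: a_r_coset_def')

lemma monomial_eq_cls: "set w \<subseteq> S \<times> S \<Longrightarrow> monomial S w = cls S (word w)"
  by (induction w) (auto simp: monomial_def cls_one word_Cons cls_mult tensors_gen tensors_word)

lemma cls_zero: "cls S 0 = \<zero>\<^bsub>UEA S\<^esub>"
  using ring_hom_zero[OF cls_hom ring_tensor_alg ring_UEA] by simp

lemma cls_sum:
  assumes "finite A" "\<And>i. i \<in> A \<Longrightarrow> f i \<in> tensors S"
  shows "(\<Oplus>\<^bsub>UEA S\<^esub>i\<in>A. cls S (f i)) = cls S (\<Sum>i\<in>A. f i)"
proof -
  interpret U: ring "UEA S" by (rule ring_UEA)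
  show ?thesis
    using assms
  proof (induction A rule: finite_induct)
    case (insert i A)
    then show ?case
      using U.finsum_insert[of A i "\<lambda>i. cls S (f i)"]
      by (auto simp: cls_carrier cls_add tensors_sum)
  qed (simp add: cls_zero)
qed

text \<open>Representatives that agree modulo the smaller ideal agree modulo the larger one, so
  \<open>the_elem\<close> is applied to a singleton.\<close>

lemma inclusion_cls:
  assumes "x \<in> tensors (sym_L n)"
  shows "inclusion m0 m1 n (cls (sym_L n) x) = cls (symbols m0 m1 n) x"
proof -
  let ?L = "sym_L n" and ?S = "symbols m0 m1 n"
  have LS: "?L \<subseteq> ?S" by (auto simp: symbols_def)
  have eq: "cls ?S y = cls ?S x" if "y \<in> cls ?L x" for y
    using cls_memD[OF that assms] assms enveloping_ideal_mono[OF LS] tensors_mono[OF LS]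
    by (subst cls_eq_iff) auto
  have "cls ?S ` cls ?L x = (\<lambda>_. cls ?S x) ` cls ?L x"
    by (rule image_cong[OF refl eq])
  also have "\<dots> = {cls ?S x}"
    using cls_self[OF assms] by (rule image_constant)
  finally have "cls ?S ` cls ?L x = {cls ?S x}" .
  then show ?thesis by (simp add: inclusion_def)
qed

section \<open>Representations\<close>

definition word_act :: "(symbol \<Rightarrow> symbol \<Rightarrow> 'v \<Rightarrow> 'v) \<Rightarrow> letter list \<Rightarrow> 'v \<Rightarrow> 'v" where
  "word_act E w v = foldr (\<lambda>(a, b). E a b) w v"

definition tact ::
  "(complex \<Rightarrow> 'v::ab_group_add \<Rightarrow> 'v) \<Rightarrow> (symbol \<Rightarrow> symbol \<Rightarrow> 'v \<Rightarrow> 'v) \<Rightarrow> tensor \<Rightarrow> 'v \<Rightarrow> 'v" where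
  "tact smul E x v =
    (\<Sum>w\<in>Poly_Mapping.keys x. smul (Poly_Mapping.lookup x w) (word_act E w v))"

lemma tensor_action_eq_tact: "tensor_action smul \<rho> = tact smul (\<lambda>a b. \<rho> (idx a) (idx b))"
  by (simp add: tensor_action_def tact_def word_act_def fun_eq_iff)

lemma word_act_simps [simp]:
  "word_act E [] v = v"
  "word_act E ((a, b) # w) v = E a b (word_act E w v)"
  "word_act E (u @ w) v = word_act E u (word_act E w v)"
  by (simp_all add: word_act_def)

text \<open>The vector space carries no grading: the signs in \<open>E_rel\<close> depend on the
  symbols alone. For \<open>S = sym_L n\<close> they are all 1, so ordinary $gl(n)$-modules are
  covered as well.\<close>

locale super_rep = vector_space smul
  for smul :: "complex \<Rightarrow> 'v::ab_group_add \<Rightarrow> 'v" +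
  fixes S :: "symbol set" and E :: "symbol \<Rightarrow> symbol \<Rightarrow> 'v \<Rightarrow> 'v"
  assumes E_add: "a \<in> S \<Longrightarrow> b \<in> S \<Longrightarrow> E a b (u + v) = E a b u + E a b v"
    and E_scale: "a \<in> S \<Longrightarrow> b \<in> S \<Longrightarrow> E a b (smul r v) = smul r (E a b v)"
    and E_rel: "a \<in> S \<Longrightarrow> b \<in> S \<Longrightarrow> c \<in> S \<Longrightarrow> d \<in> S \<Longrightarrow>
      E a b (E c d v) - smul (sgn_sym a b c d) (E c d (E a b v)) =
        (if b = c then E a d v else 0) - smul (sgn_sym a b c d) (if a = d then E c b v else 0)"
begin

abbreviation act :: "tensor \<Rightarrow> 'v \<Rightarrow> 'v" where
  "act \<equiv> tact smul E"

lemma E_zero: "a \<in> S \<Longrightarrow> b \<in> S \<Longrightarrow> E a b 0 = 0"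
  using E_scale[of a b 0 0] by simp

lemma word_act_add: "set w \<subseteq> S \<times> S \<Longrightarrow> word_act E w (u + v) = word_act E w u + word_act E w v"
  by (induction w) (auto simp: E_add)

lemma word_act_scale: "set w \<subseteq> S \<times> S \<Longrightarrow> word_act E w (smul r v) = smul r (word_act E w v)"
  by (induction w) (auto simp: E_scale)

lemma word_act_zero: "set w \<subseteq> S \<times> S \<Longrightarrow> word_act E w 0 = 0"
  using word_act_scale[of w 0 0] by simp

lemma act_superset:
  assumes "finite K" "Poly_Mapping.keys x \<subseteq> K"
  shows "act x v = (\<Sum>w\<in>K. smul (Poly_Mapping.lookup x w) (word_act E w v))"
  unfolding tact_def using assms
  by (intro sum.mono_neutral_left) (auto simp: in_keys_iff)

lemma act_zero [simp]: "act 0 v = 0"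
  by (simp add: tact_def)

lemma act_add: "act (x + y) v = act x v + act y v"
proof -
  let ?K = "Poly_Mapping.keys x \<union> Poly_Mapping.keys y"
  have "act (x + y) v = (\<Sum>w\<in>?K. smul (Poly_Mapping.lookup (x + y) w) (word_act E w v))"
    by (rule act_superset) (use Poly_Mapping.keys_add[of x y] in auto)
  also have "\<dots> = act x v + act y v"
    by (subst (1 2) act_superset[of ?K]) (auto simp: lookup_add scale_left_distrib sum.distrib)
  finally show ?thesis .
qed

lemma act_single: "act (Poly_Mapping.single w c) v = smul c (word_act E w v)"
  by (simp add: tact_def)

lemma act_word [simp]: "act (word w) v = word_act E w v"
  by (simp add: word_def act_single)

lemma act_const [simp]: "act (const c) v = smul c v"
  by (simp add: act_single zero_list_def)

lemma act_one [simp]: "act 1 v = v"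
  using act_const[of 1] by simp

lemma act_gen [simp]: "act (gen a b) v = E a b v"
  by (simp add: gen_def act_single)

lemma act_vec_add: "x \<in> tensors S \<Longrightarrow> act x (u + v) = act x u + act x v"
  by (induction rule: tensor_induct)
    (auto simp: act_single act_add word_act_add scale_right_distrib algebra_simps)

lemma act_vec_scale: "x \<in> tensors S \<Longrightarrow> act x (smul r v) = smul r (act x v)"
  by (induction rule: tensor_induct)
    (auto simp: act_single act_add word_act_scale scale_right_distrib scale_left_commute)

lemma act_vec_zero: "x \<in> tensors S \<Longrightarrow> act x 0 = 0"
  using act_vec_scale[of x 0 0] by simp

lemma act_uminus: "act (- x) v = - act x v"
  using act_add[of x "- x" v] by (simp add: eq_neg_iff_add_eq_0 add.commute)

lemma act_diff: "act (x - y) v = act x v - act y v"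
  using act_add[of x "- y" v] by (simp add: act_uminus)

lemma act_sum: "act (\<Sum>i\<in>A. f i) v = (\<Sum>i\<in>A. act (f i) v)"
  by (induction A rule: infinite_finite_induct) (auto simp: act_add)

text \<open>Only the left factor is restricted to letters from \<open>S\<close>: its words must act
  linearly on the sum produced by the right factor, and linearity is known for \<open>E a b\<close>
  with a, b in \<open>S\<close> only.\<close>

lemma act_mult:
  assumes "x \<in> tensors S"
  shows "act (x * y) v = act x (act y v)"
  using assms
proof (induction rule: tensor_induct)
  case (single w c)
  have "y \<in> tensors UNIV" by (simp add: tensors_def)
  then show ?case
  proof (induction rule: tensor_induct)
    case zero
    then show ?case using act_vec_zero[of "Poly_Mapping.single w c"] single by (simp add: tensors_single)
  next
    case (single u d)
    then show ?case
      using \<open>set w \<subseteq> S \<times> S\<close> by (simp add: mult_single act_single plus_list_def word_act_scale)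
  next
    case (add x y)
    then show ?case
      using single by (simp add: distrib_left act_add act_vec_add tensors_single)
  qed
qed (auto simp: distrib_right act_add)

lemma act_enveloping_ideal:
  assumes "x \<in> enveloping_ideal S"
  shows "act x v = 0"
proof -
  \<comment> \<open>All vectors at once: right multiplication replaces \<open>v\<close> by another
    vector, so the annihilator of a single vector would be only a left ideal.\<close>
  have "ideal {x \<in> tensors S. \<forall>v. act x v = 0} (tensor_alg S)"
    by (rule ideal_tensor_algI) (auto simp: act_add act_mult act_vec_zero)
  moreover have "act (gl_rel a b c d) v = 0" if "a \<in> S" "b \<in> S" "c \<in> S" "d \<in> S" for a b c d v
    using E_rel[OF that, of v] that
    by (simp add: gl_rel_eq act_diff act_mult tensors_gen tensors_mult if_distrib[of "\<lambda>x. smul x y" for y]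
        cong: if_cong)
  ultimately have "enveloping_ideal S \<subseteq> {x \<in> tensors S. \<forall>v. act x v = 0}"
    by (intro enveloping_ideal_minimal) (auto simp: gl_rel_tensors)
  then show ?thesis using assms by auto
qed

lemma act_cong_cls:
  assumes "y \<in> cls S x" "x \<in> tensors S"
  shows "act y v = act x v"
  using act_enveloping_ideal[OF cls_memD(2)[OF assms], of v] by (simp add: act_diff)

end

context gl_module
begin

lemma rho_add: "i \<in> {1..n} \<Longrightarrow> j \<in> {1..n} \<Longrightarrow> \<rho> i j (u + v) = \<rho> i j u + \<rho> i j v"
  and rho_scale: "i \<in> {1..n} \<Longrightarrow> j \<in> {1..n} \<Longrightarrow> \<rho> i j (smul c v) = smul c (\<rho> i j v)"
proof -
  assume "i \<in> {1..n}" "j \<in> {1..n}"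
  then interpret Vector_Spaces.linear smul smul "\<rho> i j" by (rule rho_linear)
  show "\<rho> i j (u + v) = \<rho> i j u + \<rho> i j v" "\<rho> i j (smul c v) = smul c (\<rho> i j v)"
    by (rule add, rule scale)
qed

lemma super_rep: "super_rep smul (sym_L n) (\<lambda>a b. \<rho> (idx a) (idx b))"
proof unfold_locales
  fix a b c d v
  assume "a \<in> sym_L n" "b \<in> sym_L n" "c \<in> sym_L n" "d \<in> sym_L n"
  then obtain i j k l where
    "a = Proper i" "b = Proper j" "c = Proper k" "d = Proper l"
    "i \<in> {1..n}" "j \<in> {1..n}" "k \<in> {1..n}" "l \<in> {1..n}"
    by (auto simp: sym_L_def)
  then show "\<rho> (idx a) (idx b) (\<rho> (idx c) (idx d) v) -
      smul (sgn_sym a b c d) (\<rho> (idx c) (idx d) (\<rho> (idx a) (idx b) v)) =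
      (if b = c then \<rho> (idx a) (idx d) v else 0) -
      smul (sgn_sym a b c d) (if a = d then \<rho> (idx c) (idx b) v else 0)"
    using rho_bracket[of i j k l v] by (simp add: sgn_sym_def)
qed (auto simp: sym_L_def rho_add rho_scale)

lemma U_action_cls:
  assumes "x \<in> tensors (sym_L n)"
  shows "U_action smul \<rho> (cls (sym_L n) x) v = tact smul (\<lambda>a b. \<rho> (idx a) (idx b)) x v"
proof -
  interpret R: super_rep smul "sym_L n" "\<lambda>a b. \<rho> (idx a) (idx b)" by (rule super_rep)
  have "(\<lambda>y. R.act y v) ` cls (sym_L n) x = (\<lambda>_. R.act x v) ` cls (sym_L n) x"
    by (rule image_cong[OF refl R.act_cong_cls[OF _ assms]])
  also have "\<dots> = {R.act x v}"
    using cls_self[OF assms] by (rule image_constant)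
  finally show ?thesis
    by (simp add: U_action_def tensor_action_eq_tact)
qed

end

section \<open>A Fock space representation\<close>

text \<open>The variables $x_{a,s}$ are numbered because the fermionic signs need a linear order on
  them. The residue modulo 3 keeps the three kinds of symbols apart.\<close>

fun mode :: "symbol \<Rightarrow> nat \<Rightarrow> nat" where
  "mode (Alpha i) s = prod_encode (3 * i, s)"
| "mode (Beta i) s = prod_encode (3 * i + 1, s)"
| "mode (Proper i) s = prod_encode (3 * i + 2, s)"

lemma mode_inj [simp]: "mode a s = mode b t \<longleftrightarrow> a = b \<and> s = t"
  by (cases a; cases b) (auto simp: prod_encode_eq; presburger)+

text \<open>
  A basis state lists the occupied fermionic modes and the occupation numbers of the bosonic ones.
  The signs $(-1)^{|\{q \in F.\; q < p\}|}$ make the fermionic operators anticommute.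
\<close>

type_synonym fock = "nat set \<times> (nat \<Rightarrow> nat) \<Rightarrow> complex"

definition jw_sign :: "nat \<Rightarrow> nat set \<Rightarrow> complex" where
  "jw_sign p F = (\<Prod>q<p. if q \<in> F then - 1 else 1)"

text \<open>Vectors are arbitrary coefficient functions on basis states, so an operator is given by
  the state from which each new coefficient is read: creation looks back at the state without p,
  annihilation at the state with p.\<close>

definition fcre :: "nat \<Rightarrow> fock \<Rightarrow> fock" where
  "fcre p f = (\<lambda>(F, m). if p \<in> F then jw_sign p F * f (F - {p}, m) else 0)"

definition fann :: "nat \<Rightarrow> fock \<Rightarrow> fock" where
  "fann p f = (\<lambda>(F, m). if p \<in> F then 0 else jw_sign p F * f (insert p F, m))"

definition bcre :: "nat \<Rightarrow> fock \<Rightarrow> fock" where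
  "bcre p f = (\<lambda>(F, m). if m p = 0 then 0 else f (F, m(p := m p - 1)))"

text \<open>The factor comes from differentiating $x^{m+1}$, whose derivative feeds the coefficient
  at $x^m$.\<close>

definition bann :: "nat \<Rightarrow> fock \<Rightarrow> fock" where
  "bann p f = (\<lambda>(F, m). of_nat (m p + 1) * f (F, m(p := m p + 1)))"

lemma jw_sign_insert: "p \<notin> F \<Longrightarrow> jw_sign q (insert p F) = (if p < q then - jw_sign q F else jw_sign q F)"
proof -
  assume "p \<notin> F"
  have "jw_sign q (insert p F) = (\<Prod>r<q. (if r = p then - 1 else 1) * (if r \<in> F then - 1 else 1))"
    unfolding jw_sign_def using \<open>p \<notin> F\<close> by (intro prod.cong) auto
  also have "\<dots> = (\<Prod>r<q. if r = p then - 1 else 1) * jw_sign q F"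
    by (simp add: prod.distrib jw_sign_def)
  also have "(\<Prod>r<q. if r = p then - 1 else (1::complex)) = (if p < q then - 1 else 1)"
    by (subst prod.delta) auto
  finally show ?thesis by simp
qed

lemma jw_sign_remove: "p \<in> F \<Longrightarrow> jw_sign q (F - {p}) = (if p < q then - jw_sign q F else jw_sign q F)"
  using jw_sign_insert[of p "F - {p}" q] by (simp add: insert_absorb)

lemma jw_sign_square: "jw_sign p F * jw_sign p F = 1"
  unfolding jw_sign_def by (simp flip: prod.distrib) (auto intro!: prod.neutral)

lemma jw_sign_square_left: "jw_sign p F * (jw_sign p F * x) = x"
  by (simp flip: mult.assoc add: jw_sign_square)

text \<open>The smaller of two distinct modes is seen by the sign of the larger one, so exactly one
  of the two orders picks up a minus.\<close>

lemma fcre_fcre: "fcre p (fcre q f) = - fcre q (fcre p f)"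
proof (rule ext, clarify)
  fix F m
  have "F - {p} - {q} = F - {q} - {p}" by auto
  then show "fcre p (fcre q f) (F, m) = (- fcre q (fcre p f)) (F, m)"
    by (cases p q rule: linorder_cases) (auto simp: fcre_def jw_sign_remove)
qed

lemma fann_fann: "fann p (fann q f) = - fann q (fann p f)"
proof (rule ext, clarify)
  fix F m
  show "fann p (fann q f) (F, m) = (- fann q (fann p f)) (F, m)"
    by (cases p q rule: linorder_cases) (auto simp: fann_def jw_sign_insert insert_commute)
qed

lemma fann_fcre: "fann p (fcre q f) = (if p = q then f else 0) - fcre q (fann p f)"
proof (rule ext, clarify)
  fix F m
  have "p \<noteq> q \<Longrightarrow> insert p F - {q} = insert p (F - {q})" by auto
  then show "fann p (fcre q f) (F, m) = ((if p = q then f else 0) - fcre q (fann p f)) (F, m)"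
    by (cases p q rule: linorder_cases)
      (auto simp: fann_def fcre_def jw_sign_remove jw_sign_insert insert_absorb jw_sign_square_left)
qed

lemma bcre_bcre: "bcre p (bcre q f) = bcre q (bcre p f)"
  by (auto simp: bcre_def fun_eq_iff fun_upd_twist)

lemma bann_bann: "bann p (bann q f) = bann q (bann p f)"
  by (auto simp: bann_def fun_eq_iff fun_upd_twist)

lemma bann_bcre: "bann p (bcre q f) = (if p = q then f else 0) + bcre q (bann p f)"
  by (auto simp: bann_def bcre_def fun_eq_iff fun_upd_twist algebra_simps of_nat_diff)

lemma bf_commute:
  "bcre p (fcre q f) = fcre q (bcre p f)"
  "bcre p (fann q f) = fann q (bcre p f)"
  "bann p (fcre q f) = fcre q (bann p f)"
  "bann p (fann q f) = fann q (bann p f)"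
  by (auto simp: bann_def bcre_def fann_def fcre_def fun_eq_iff)

definition cre :: "symbol \<Rightarrow> nat \<Rightarrow> fock \<Rightarrow> fock" where
  "cre a s = (if parity a = 0 then bcre else fcre) (mode a s)"

definition ann :: "symbol \<Rightarrow> nat \<Rightarrow> fock \<Rightarrow> fock" where
  "ann a s = (if parity a = 0 then bann else fann) (mode a s)"

definition fscale :: "complex \<Rightarrow> fock \<Rightarrow> fock" where
  "fscale c f = (\<lambda>\<sigma>. c * f \<sigma>)"

interpretation fock: vector_space fscale
  by unfold_locales (auto simp: fscale_def fun_eq_iff algebra_simps)

lemma cre_linear:
  "cre a s (f + g) = cre a s f + cre a s g" "cre a s (fscale c f) = fscale c (cre a s f)"
  by (auto simp: cre_def bcre_def fcre_def fscale_def fun_eq_iff algebra_simps)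

lemma ann_linear:
  "ann a s (f + g) = ann a s f + ann a s g" "ann a s (fscale c f) = fscale c (ann a s f)"
  by (auto simp: ann_def bann_def fann_def fscale_def fun_eq_iff algebra_simps)

text \<open>The sign of exchanging two variables or derivatives: negative only if both symbols are
  odd.\<close>

definition par2 :: "symbol \<Rightarrow> symbol \<Rightarrow> complex" where
  "par2 a b = (- 1) ^ (parity a * parity b)"

lemma parity_cases: "parity a = 0 \<or> parity a = 1"
  by (cases a) auto

lemma fscale_minus_one: "fscale (- 1) f = - f"
  by (auto simp: fscale_def fun_eq_iff)

lemma cre_cre: "cre a s (cre b t f) = fscale (par2 a b) (cre b t (cre a s f))"
  using parity_cases[of a] parity_cases[of b]
  by (auto simp: cre_def par2_def bcre_bcre bf_commute fcre_fcre[of "mode a s"] fscale_minus_one)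

lemma ann_ann: "ann a s (ann b t f) = fscale (par2 a b) (ann b t (ann a s f))"
  using parity_cases[of a] parity_cases[of b]
  by (auto simp: ann_def par2_def bann_bann bf_commute fann_fann[of "mode a s"] fscale_minus_one)

lemma ann_cre:
  "ann a s (cre b t f) = (if a = b \<and> s = t then f else 0) + fscale (par2 a b) (cre b t (ann a s f))"
proof -
  have "fscale 1 g = g" "fscale (- 1) g = - g" for g
    by (auto simp: fscale_def fun_eq_iff)
  moreover have "parity a \<noteq> parity b \<Longrightarrow> a \<noteq> b" by auto
  ultimately show ?thesis
    using parity_cases[of a] parity_cases[of b]
    by (auto simp: ann_def cre_def par2_def bann_bcre fann_fcre bf_commute)
qed

definition fockE :: "nat \<Rightarrow> symbol \<Rightarrow> symbol \<Rightarrow> fock \<Rightarrow> fock" where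
  "fockE d a b f = (\<Sum>s=1..d. cre a s (ann b s f))"

lemma cre_zero [simp]: "cre a s 0 = 0"
  using cre_linear(2)[of a s 0 0] unfolding fock.scale_zero_left .

lemma ann_zero [simp]: "ann a s 0 = 0"
  using ann_linear(2)[of a s 0 0] unfolding fock.scale_zero_left .

lemma cre_sum: "cre a s (\<Sum>i\<in>A. g i) = (\<Sum>i\<in>A. cre a s (g i))"
  by (induction A rule: infinite_finite_induct) (simp_all add: cre_linear del: zero_fun_apply plus_fun_apply)

lemma ann_sum: "ann a s (\<Sum>i\<in>A. g i) = (\<Sum>i\<in>A. ann a s (g i))"
  by (induction A rule: infinite_finite_induct) (simp_all add: ann_linear del: zero_fun_apply plus_fun_apply)

text \<open>Moving $x_a \<partial>_b$ past $x_c \<partial>_e$ makes four exchanges, whose signs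
  multiply to \<open>sgn_sym a b c e\<close>. Three of them cancel here and the exchange of b and c
  is left.\<close>

lemma par2_sgn: "sgn_sym a b c e * (par2 e a * (par2 c a * par2 e b)) = par2 b c"
  using parity_cases[of a] parity_cases[of b] parity_cases[of c] parity_cases[of e]
  by (auto simp: par2_def sgn_sym_def)

text \<open>Both products are brought to the same normally ordered form \<open>?X\<close> with the
  same sign. It cancels, and only the contractions remain.\<close>

lemma cre_ann_rel:
  "cre a s (ann b s (cre c t (ann e t f))) -
      fscale (sgn_sym a b c e) (cre c t (ann e t (cre a s (ann b s f)))) =
    (if s = t then (if b = c then cre a s (ann e s f) else 0) -
      fscale (sgn_sym a b c e) (if a = e then cre c s (ann b s f) else 0) else 0)"
proof -
  let ?X = "cre a s (cre c t (ann b s (ann e t f)))"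
  have 1: "cre a s (ann b s (cre c t (ann e t f))) =
      (if b = c \<and> s = t then cre a s (ann e s f) else 0) + fscale (par2 b c) ?X"
    by (simp add: ann_cre cre_linear)
  have "cre c t (ann e t (cre a s (ann b s f))) =
      (if a = e \<and> s = t then cre c s (ann b s f) else 0) +
      fscale (par2 e a) (cre c t (cre a s (ann e t (ann b s f))))"
    by (simp add: ann_cre cre_linear)
  also have "cre c t (cre a s (ann e t (ann b s f))) = fscale (par2 c a * par2 e b) ?X"
    by (simp add: cre_cre[of c t] ann_ann[of e t] cre_linear fock.scale_left_commute)
  finally have 2: "fscale (sgn_sym a b c e) (cre c t (ann e t (cre a s (ann b s f)))) =
      fscale (sgn_sym a b c e) (if a = e \<and> s = t then cre c s (ann b s f) else 0) +
      fscale (par2 b c) ?X"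
    by (simp add: fock.scale_right_distrib par2_sgn del: zero_fun_apply plus_fun_apply)
  show ?thesis
    unfolding 1 2 by simp
qed

text \<open>Summed over s and t, only the diagonal contractions survive, and they form the
  superbracket. Taking all symbols at once serves both the large superalgebra and $gl(n)$.\<close>

interpretation fock: super_rep fscale UNIV "fockE d" for d
proof unfold_locales
  fix a b c e :: symbol and f :: fock
  have "fockE d a b (fockE d c e f) - fscale (sgn_sym a b c e) (fockE d c e (fockE d a b f)) =
    (\<Sum>s=1..d. \<Sum>t=1..d. cre a s (ann b s (cre c t (ann e t f)))) -
    (\<Sum>t=1..d. \<Sum>s=1..d. fscale (sgn_sym a b c e) (cre c t (ann e t (cre a s (ann b s f)))))"
    unfolding fockE_def by (simp add: cre_sum ann_sum fock.scale_sum_right)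
  also have "(\<Sum>t=1..d. \<Sum>s=1..d. fscale (sgn_sym a b c e) (cre c t (ann e t (cre a s (ann b s f))))) =
    (\<Sum>s=1..d. \<Sum>t=1..d. fscale (sgn_sym a b c e) (cre c t (ann e t (cre a s (ann b s f)))))"
    by (rule sum.swap)
  also have "(\<Sum>s=1..d. \<Sum>t=1..d. cre a s (ann b s (cre c t (ann e t f)))) - \<dots> =
    (\<Sum>s=1..d. \<Sum>t=1..d. if s = t then (if b = c then cre a s (ann e s f) else 0) -
      fscale (sgn_sym a b c e) (if a = e then cre c s (ann b s f) else 0) else 0)"
    unfolding sum_subtractf[symmetric] cre_ann_rel ..
  also have "\<dots> = (\<Sum>s=1..d. (if b = c then cre a s (ann e s f) else 0) -
      fscale (sgn_sym a b c e) (if a = e then cre c s (ann b s f) else 0))"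
    by (intro sum.cong refl) (simp add: sum.delta)
  also have "\<dots> = (if b = c then fockE d a e f else 0) -
      fscale (sgn_sym a b c e) (if a = e then fockE d c b f else 0)"
    by (simp add: fockE_def sum_subtractf fock.scale_sum_right)
  finally show "fockE d a b (fockE d c e f) -
      fscale (sgn_sym a b c e) (fockE d c e (fockE d a b f)) =
    (if b = c then fockE d a e f else 0) -
      fscale (sgn_sym a b c e) (if a = e then fockE d c b f else 0)" .
qed (auto simp: fockE_def cre_linear ann_linear sum.distrib fock.scale_sum_right)

section \<open>The state of a diagram\<close>

definition fock_state :: "nat set \<Rightarrow> fock" where
  "fock_state F0 = (\<lambda>(F, m). if F = F0 \<and> m = (\<lambda>_. 0) then 1 else 0)"

definition diagram_state :: "nat \<Rightarrow> (nat \<Rightarrow> nat) \<Rightarrow> nat set" where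
  "diagram_state n \<kappa> = {mode (Proper i) s | i s. i \<in> {1..n} \<and> s \<in> {1..\<kappa> i}}"

lemma mode_in_diagram_state:
  "mode a s \<in> diagram_state n \<kappa> \<longleftrightarrow> (\<exists>i\<in>{1..n}. a = Proper i \<and> s \<in> {1..\<kappa> i})"
  unfolding diagram_state_def mem_Collect_eq mode_inj by blast

lemma fock_state_nonzero: "fock_state F0 \<noteq> 0"
  by (auto simp: fock_state_def fun_eq_iff intro!: exI[of _ F0] exI[of _ "\<lambda>_. 0"])

lemma ann_fock_state_eq_0:
  assumes "mode b s \<notin> F0"
  shows "ann b s (fock_state F0) = 0"
  using assms by (auto simp: ann_def bann_def fann_def fock_state_def fun_eq_iff)

lemma cre_ann_fock_state_eq_0:
  assumes "mode a s \<in> F0" "parity a = 1" "parity b = 1" "a \<noteq> b"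
  shows "cre a s (ann b s (fock_state F0)) = 0"
  using assms by (auto simp: ann_def cre_def fcre_def fann_def fock_state_def fun_eq_iff)

lemma cre_ann_same_fock_state:
  assumes "mode a s \<in> F0" "parity a = 1"
  shows "cre a s (ann a s (fock_state F0)) = fock_state F0"
  using assms
  by (auto simp: ann_def cre_def fcre_def fann_def fock_state_def fun_eq_iff jw_sign_remove
      jw_sign_square insert_absorb)

lemma fockE_diagram_virtual:
  assumes "\<And>i. b \<noteq> Proper i"
  shows "fockE d a b (fock_state (diagram_state n \<kappa>)) = 0"
  using assms by (auto simp: fockE_def ann_fock_state_eq_0 mode_in_diagram_state)

text \<open>The operator replaces $x_{j,s}$ by $x_{i,s}$. Either $x_{j,s}$ is absent, or $s \<le>
  \<kappa>_j \<le> \<kappa>_i$ and the odd variable $x_{i,s}$ would occur twice.\<close>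

lemma fockE_diagram_raising:
  assumes "i < j" "i \<in> {1..n}" "\<kappa> j \<le> \<kappa> i"
  shows "fockE d (Proper i) (Proper j) (fock_state (diagram_state n \<kappa>)) = 0"
  unfolding fockE_def
proof (intro sum.neutral ballI)
  fix s assume "s \<in> {1..d}"
  show "cre (Proper i) s (ann (Proper j) s (fock_state (diagram_state n \<kappa>))) = 0"
  proof (cases "s \<le> \<kappa> j")
    case True
    with assms \<open>s \<in> {1..d}\<close> show ?thesis
      by (intro cre_ann_fock_state_eq_0) (auto simp: mode_in_diagram_state simp del: mode.simps)
  next
    case False
    then show ?thesis
      by (simp add: ann_fock_state_eq_0 mode_in_diagram_state del: mode.simps)
  qed
qed

text \<open>Each occupied $x_{i,s}$ contributes 1; the bound by d ensures that the sum reaches all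
  of them.\<close>

lemma fockE_diagram_weight:
  assumes "i \<in> {1..n}" "\<kappa> i \<le> d"
  shows "fockE d (Proper i) (Proper i) (fock_state (diagram_state n \<kappa>)) =
    fscale (of_nat (\<kappa> i)) (fock_state (diagram_state n \<kappa>))"
proof -
  let ?v = "fock_state (diagram_state n \<kappa>)"
  have "fockE d (Proper i) (Proper i) ?v = (\<Sum>s=1..d. if s \<in> {1..\<kappa> i} then ?v else 0)"
    unfolding fockE_def
    by (intro sum.cong refl)
      (use assms in \<open>auto simp: ann_fock_state_eq_0 cre_ann_same_fock_state mode_in_diagram_state
          simp del: mode.simps\<close>)
  also have "\<dots> = (\<Sum>s\<in>{1..\<kappa> i}. ?v)"
    using assms by (intro sum.mono_neutral_cong_right) auto
  also have "\<dots> = fscale (of_nat (\<kappa> i)) ?v"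
    by (simp add: fscale_def fun_eq_iff)
  finally show ?thesis .
qed

section \<open>Vertical strips\<close>

text \<open>Falling factorial over the integers, since the arguments below are differences that may
  be negative.\<close>

definition ffall :: "int \<Rightarrow> nat \<Rightarrow> int" where
  "ffall x h = (\<Prod>t<h. x - int t)"

lemma ffall_0 [simp]: "ffall x 0 = 1"
  and ffall_Suc: "ffall x (Suc h) = ffall x h * (x - int h)"
  by (simp_all add: ffall_def)

lemma ffall_eq_binomial_fact: "int (n choose h) * fact h = ffall (int n) h"
proof (induction h)
  case (Suc h)
  have "int (n choose Suc h) * fact (Suc h) = int (Suc h * (n choose Suc h)) * fact h"
    by (simp add: algebra_simps)
  also have "Suc h * (n choose Suc h) = (n - h) * (n choose h)"
    by (metis binomial_absorb_comp binomial_absorption mult.commute)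
  also have "int ((n - h) * (n choose h)) * fact h = (int (n choose h) * fact h) * int (n - h)"
    by (simp only: of_nat_mult ac_simps)
  also have "\<dots> = ffall (int n) h * int (n - h)"
    by (simp only: Suc)
  also have "\<dots> = ffall (int n) (Suc h)"
  \<comment> \<open>For h > n both sides contain \<open>ffall (int n) h\<close>, which vanishes
    through its factor at t = n.\<close>
  proof (cases "h \<le> n")
    case False
    then have "ffall (int n) h = 0"
      by (auto simp: ffall_def intro!: bexI[of _ n])
    then show ?thesis by (simp add: ffall_Suc)
  qed (simp add: ffall_Suc of_nat_diff)
  finally show ?case .
qed simp

text \<open>The common mechanism for comparing the combinatorial sums: each is determined by its
  value past the last column and by what one more column on the left contributes.\<close>

lemma column_recursion_unique:
  fixes X Y :: "nat \<Rightarrow> nat \<Rightarrow> int"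
  assumes "\<And>k. X (Suc n) k = Y (Suc n) k"
    and "\<And>c k. 1 \<le> c \<Longrightarrow> c \<le> n \<Longrightarrow> X c k = (\<Sum>h\<le>k. X (Suc c) (k - h) * w c k h)"
    and "\<And>c k. 1 \<le> c \<Longrightarrow> c \<le> n \<Longrightarrow> Y c k = (\<Sum>h\<le>k. Y (Suc c) (k - h) * w c k h)"
    and "c \<le> Suc n" "1 \<le> c"
  shows "X c k = Y c k"
  using assms(4,5)
proof (induction arbitrary: k rule: inc_induct)
  case (step c)
  then show ?case by (simp add: assms(2,3))
qed (simp add: assms(1))

section \<open>Sums over weakly increasing sequences\<close>

definition sorted_lists :: "nat \<Rightarrow> nat \<Rightarrow> nat \<Rightarrow> nat list set" where
  "sorted_lists n c k = {xs. length xs = k \<and> sorted xs \<and> set xs \<subseteq> {c..n}}"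

definition list_sum :: "(nat \<Rightarrow> int) \<Rightarrow> nat \<Rightarrow> nat \<Rightarrow> nat \<Rightarrow> int" where
  "list_sum l n c k =
    (\<Sum>xs\<in>sorted_lists n c k. \<Prod>s=1..k. (l (xs ! (s - 1)) - int k + int s))"

lemma finite_sorted_lists [simp]: "finite (sorted_lists n c k)"
  by (rule finite_subset[OF _ finite_lists_length_eq[of "{c..n}" k]]) (auto simp: sorted_lists_def)

lemma sorted_lists_Suc:
  assumes "c \<le> n"
  shows "sorted_lists n c (Suc k) = sorted_lists n (Suc c) (Suc k) \<union> (#) c ` sorted_lists n c k"
proof (intro equalityI subsetI)
  fix xs assume xs: "xs \<in> sorted_lists n c (Suc k)"
  then obtain y ys where eq: "xs = y # ys" by (cases xs) (auto simp: sorted_lists_def)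
  show "xs \<in> sorted_lists n (Suc c) (Suc k) \<union> (#) c ` sorted_lists n c k"
  proof (cases "y = c")
    case True
    then show ?thesis using xs eq by (auto simp: sorted_lists_def)
  next
    case False
    then have "Suc c \<le> y" using xs eq by (auto simp: sorted_lists_def)
    then have "xs \<in> sorted_lists n (Suc c) (Suc k)"
      using xs eq by (fastforce simp: sorted_lists_def)
    then show ?thesis by simp
  qed
qed (use assms in \<open>fastforce simp: sorted_lists_def\<close>)

text \<open>Split by whether the first, hence smallest, entry is c. If so, position s = 1 gives the
  factor l c - (k + 1) + 1, and renumbering the other positions from 1 turns their product into the
  one for k.\<close>

lemma list_sum_Suc:
  assumes "c \<le> n"
  shows "list_sum l n c (Suc k) = list_sum l n (Suc c) (Suc k) + (l c - int k) * list_sum l n c k"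
proof -
  let ?f = "\<lambda>xs. \<Prod>s=1..Suc k. (l (xs ! (s - 1)) - int (Suc k) + int s)"
  have "list_sum l n c (Suc k) =
      (\<Sum>xs\<in>sorted_lists n (Suc c) (Suc k). ?f xs) + (\<Sum>xs\<in>(#) c ` sorted_lists n c k. ?f xs)"
    unfolding list_sum_def sorted_lists_Suc[OF assms]
    by (intro sum.union_disjoint finite_imageI finite_sorted_lists) (auto simp: sorted_lists_def)
  also have "(\<Sum>xs\<in>(#) c ` sorted_lists n c k. ?f xs) = (\<Sum>xs\<in>sorted_lists n c k. ?f (c # xs))"
    by (subst sum.reindex) auto
  also have "\<dots> = (\<Sum>xs\<in>sorted_lists n c k.
      (l c - int k) * (\<Prod>s=1..k. (l (xs ! (s - 1)) - int k + int s)))"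
  proof (intro sum.cong refl)
    fix xs
    have "?f (c # xs) = (l c - int k) * (\<Prod>s=Suc 1..Suc k. (l ((c # xs) ! (s - 1)) - int (Suc k) + int s))"
      by (subst prod.atLeast_Suc_atMost) auto
    also have "(\<Prod>s=Suc 1..Suc k. (l ((c # xs) ! (s - 1)) - int (Suc k) + int s)) =
        (\<Prod>s=1..k. (l (xs ! (s - 1)) - int k + int s))"
      by (subst prod.atLeast_Suc_atMost_Suc_shift) (auto intro!: prod.cong simp: nth_Cons')
    finally show "?f (c # xs) =
      (l c - int k) * (\<Prod>s=1..k. (l (xs ! (s - 1)) - int k + int s))" .
  qed
  finally show ?thesis by (simp add: list_sum_def sum_distrib_left)
qed

lemma list_sum_0 [simp]: "list_sum l n c 0 = 1"
proof -
  have "sorted_lists n c 0 = {[]}" by (auto simp: sorted_lists_def)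
  then show ?thesis by (simp add: list_sum_def)
qed

lemma list_sum_empty: "list_sum l n (Suc n) k = (if k = 0 then 1 else 0)"
proof (cases k)
  case (Suc k')
  then have "sorted_lists n (Suc n) k = {}" by (auto simp: sorted_lists_def)
  then show ?thesis using Suc by (simp add: list_sum_def)
qed simp

text \<open>Here h is the number of entries equal to c. These come first in the list, and their
  factors form the falling factorial.\<close>

lemma list_sum_column:
  assumes "c \<le> n"
  shows "list_sum l n c k =
    (\<Sum>h\<le>k. list_sum l n (Suc c) (k - h) * ffall (l c - int (k - h)) h)"
proof (induction k)
  case (Suc k)
  have "(\<Sum>h\<le>Suc k. list_sum l n (Suc c) (Suc k - h) * ffall (l c - int (Suc k - h)) h) =
      list_sum l n (Suc c) (Suc k) +
      (\<Sum>h\<le>k. list_sum l n (Suc c) (k - h) * ffall (l c - int (k - h)) (Suc h))"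
    by (subst sum.atMost_Suc_shift) simp
  \<comment> \<open>The last factor of \<open>ffall\<close> is l c - (k - h) - h = l c - k, the same
    for every h, so it can be pulled out of the sum.\<close>
  also have "(\<Sum>h\<le>k. list_sum l n (Suc c) (k - h) * ffall (l c - int (k - h)) (Suc h)) =
      (\<Sum>h\<le>k. (l c - int k) * (list_sum l n (Suc c) (k - h) * ffall (l c - int (k - h)) h))"
    by (intro sum.cong refl) (simp add: ffall_Suc of_nat_diff)
  also have "\<dots> = (l c - int k) * list_sum l n c k"
    unfolding Suc by (simp add: sum_distrib_left)
  finally show ?case
    using list_sum_Suc[OF assms, of l k] by simp
qed simp

section \<open>Sums over exponent vectors\<close>

definition compositions :: "nat \<Rightarrow> nat \<Rightarrow> nat \<Rightarrow> (nat \<Rightarrow> nat) set" where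
  "compositions n c k = {h \<in> {c..n} \<rightarrow>\<^sub>E (UNIV :: nat set). (\<Sum>i=c..n. h i) = k}"

text \<open>For c = 1 this is the eigenvalue of the monomial with exponents h, already divided by
  the product of the factorials of the h i as in \<open>I_elem\<close>.\<close>

definition comp_prod :: "(nat \<Rightarrow> int) \<Rightarrow> nat \<Rightarrow> nat \<Rightarrow> (nat \<Rightarrow> nat) \<Rightarrow> int" where
  "comp_prod l n c h = (\<Prod>i=c..n. ffall (l i - int (\<Sum>j=Suc i..n. h j)) (h i))"

lemma finite_compositions [simp]: "finite (compositions n c k)"
proof (rule finite_subset)
  show "compositions n c k \<subseteq> {c..n} \<rightarrow>\<^sub>E {..k}"
  proof
    fix h assume h: "h \<in> compositions n c k"
    then have "h i \<le> k" if "i \<in> {c..n}" for i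
      using that member_le_sum[of i "{c..n}" h] by (auto simp: compositions_def)
    then show "h \<in> {c..n} \<rightarrow>\<^sub>E {..k}"
      using h by (auto simp: compositions_def PiE_iff)
  qed
qed (simp add: finite_PiE)

lemma comp_prod_column:
  assumes "c \<le> n"
  shows "(\<Sum>h\<in>compositions n c k. comp_prod l n c h) =
    (\<Sum>h\<le>k. (\<Sum>g\<in>compositions n (Suc c) (k - h). comp_prod l n (Suc c) g) *
      ffall (l c - int (k - h)) h)"
proof -
  have split: "(\<Sum>i=c..n. h i) = h c + (\<Sum>i=Suc c..n. h i)" for h :: "nat \<Rightarrow> nat"
    by (rule sum.atLeast_Suc_atMost[OF assms])
  have "(\<Sum>h\<in>compositions n c k. comp_prod l n c h) =
      (\<Sum>(h, g)\<in>(SIGMA h:{..k}. compositions n (Suc c) (k - h)).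
        comp_prod l n (Suc c) g * ffall (l c - int (k - h)) h)"
  \<comment> \<open>Column c is split off. Resetting the function to \<open>undefined\<close> at c
    keeps it extensional on the remaining columns.\<close>
  proof (rule sum.reindex_bij_witness[where i = "\<lambda>(h, g). g(c := h)"
        and j = "\<lambda>h. (h c, h(c := undefined))"])
    fix h assume h: "h \<in> compositions n c k"
    then have sum: "h c + (\<Sum>i=Suc c..n. h i) = k"
      using split[of h] by (simp add: compositions_def)
    show "(case (h c, h(c := undefined)) of (h, g) \<Rightarrow> g(c := h)) = h" by simp
    have "(\<Sum>i=Suc c..n. (h(c := undefined)) i) = (\<Sum>i=Suc c..n. h i)"
      by (intro sum.cong) auto
    then show "(h c, h(c := undefined)) \<in> (SIGMA h:{..k}. compositions n (Suc c) (k - h))"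
      using h sum by (auto simp: compositions_def PiE_iff extensional_def)
    have "comp_prod l n c h = ffall (l c - int (\<Sum>j=Suc c..n. h j)) (h c) * comp_prod l n (Suc c) h"
      unfolding comp_prod_def by (rule prod.atLeast_Suc_atMost[OF assms])
    moreover have "comp_prod l n (Suc c) (h(c := undefined)) = comp_prod l n (Suc c) h"
      unfolding comp_prod_def by (intro prod.cong refl) (auto intro!: arg_cong2[of _ _ _ _ ffall] sum.cong)
    moreover have "(\<Sum>j=Suc c..n. h j) = k - h c" using sum by simp
    ultimately show "(case (h c, h(c := undefined)) of (h, g) \<Rightarrow>
        comp_prod l n (Suc c) g * ffall (l c - int (k - h)) h) = comp_prod l n c h"
      by simp
  next
    fix p assume "p \<in> (SIGMA h:{..k}. compositions n (Suc c) (k - h))"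
    then obtain h g where p: "p = (h, g)" "h \<le> k" "g \<in> compositions n (Suc c) (k - h)" by auto
    have "(\<Sum>i=Suc c..n. (g(c := h)) i) = (\<Sum>i=Suc c..n. g i)"
      by (intro sum.cong) auto
    then show "(case p of (h, g) \<Rightarrow> g(c := h)) \<in> compositions n c k"
      using p assms split[of "g(c := h)"] by (auto simp: compositions_def PiE_iff extensional_def)
    show "((case p of (h, g) \<Rightarrow> g(c := h)) c, (case p of (h, g) \<Rightarrow> g(c := h))(c := undefined)) = p"
      using p by (auto simp: compositions_def PiE_iff extensional_def fun_eq_iff)
  qed
  also have "\<dots> = (\<Sum>h\<le>k. \<Sum>g\<in>compositions n (Suc c) (k - h).
      comp_prod l n (Suc c) g * ffall (l c - int (k - h)) h)"
    by (subst sum.Sigma) auto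
  finally show ?thesis by (simp add: sum_distrib_right)
qed

lemma compositions_empty: "(\<Sum>h\<in>compositions n (Suc n) k. comp_prod l n (Suc n) h) = (if k = 0 then 1 else 0)"
proof (cases "k = 0")
  case True
  then have "compositions n (Suc n) k = {\<lambda>_. undefined}"
    by (auto simp: compositions_def)
  then show ?thesis using True by (simp add: comp_prod_def)
next
  case False
  then have "compositions n (Suc n) k = {}" by (auto simp: compositions_def)
  then show ?thesis using False by simp
qed

section \<open>Strips, built up one column at a time from the right\<close>

definition strips :: "(nat \<Rightarrow> nat set) \<Rightarrow> nat \<Rightarrow> nat \<Rightarrow> nat \<Rightarrow> (nat \<times> nat) set set" where
  "strips R n c k = {V. V \<subseteq> {(r, j). j \<in> {c..n} \<and> r \<in> R j} \<and> card V = k \<and> inj_on fst V}"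

text \<open>\<open>R j\<close> plays the role of the set of rows that reach column j;
  \<open>R_antimono\<close> says that rows are left-justified.\<close>

context
  fixes R :: "nat \<Rightarrow> nat set"
  assumes finite_R: "\<And>j. finite (R j)"
    and R_antimono: "\<And>i j. i \<le> j \<Longrightarrow> R j \<subseteq> R i"
begin

lemma finite_cells: "finite {(r, j). j \<in> {c..n} \<and> r \<in> R j}"
proof -
  have "{(r, j). j \<in> {c..n} \<and> r \<in> R j} = prod.swap ` (SIGMA j:{c..n}. R j)"
    by (force simp: image_iff)
  then show ?thesis using finite_R by simp
qed

lemma finite_strip: "V \<in> strips R n c k \<Longrightarrow> finite V"
  using finite_cells finite_subset by (auto simp: strips_def)

lemma finite_strips [simp]: "finite (strips R n c k)"
  by (rule finite_subset[of _ "Pow {(r, j). j \<in> {c..n} \<and> r \<in> R j}"])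
    (use finite_cells in \<open>auto simp: strips_def\<close>)

lemma vstrip_fact_superset:
  assumes "finite J" "snd ` V \<subseteq> J" "finite V"
  shows "vstrip_fact V = (\<Prod>j\<in>J. fact (card {p \<in> V. snd p = j}))"
  unfolding vstrip_fact_def
proof (rule prod.mono_neutral_left[OF assms(1,2)], intro ballI)
  fix j assume "j \<in> J - snd ` V"
  then have "{p \<in> V. snd p = j} = {}" by force
  then show "fact (card {p \<in> V. snd p = j}) = 1" by (simp only: card.empty fact_0)
qed

lemma vstrip_fact_add_column:
  assumes "V \<in> strips R n (Suc c) k" "finite Q"
  shows "vstrip_fact (V \<union> Q \<times> {c}) = vstrip_fact V * fact (card Q)"
proof -
  have V: "finite V" "snd ` V \<subseteq> {Suc c..n}"
    using finite_strip[OF assms(1)] assms(1) by (auto simp: strips_def)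
  have c: "c \<notin> snd ` V" using V(2) by auto
  have "vstrip_fact (V \<union> Q \<times> {c}) =
      (\<Prod>j\<in>insert c (snd ` V). fact (card {p \<in> V \<union> Q \<times> {c}. snd p = j}))"
    using V assms(2) by (intro vstrip_fact_superset) auto
  also have "\<dots> = fact (card {p \<in> V \<union> Q \<times> {c}. snd p = c}) *
      (\<Prod>j\<in>snd ` V. fact (card {p \<in> V \<union> Q \<times> {c}. snd p = j}))"
    using V c by simp
  also have "{p \<in> V \<union> Q \<times> {c}. snd p = c} = Q \<times> {c}"
    using c by force
  also have "(\<Prod>j\<in>snd ` V. fact (card {p \<in> V \<union> Q \<times> {c}. snd p = j})) = vstrip_fact V"
    unfolding vstrip_fact_def
  proof (intro prod.cong refl)
    fix j assume "j \<in> snd ` V"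
    then have "j \<noteq> c" using c by auto
    then have "{p \<in> V \<union> Q \<times> {c}. snd p = j} = {p \<in> V. snd p = j}" by auto
    then show "fact (card {p \<in> V \<union> Q \<times> {c}. snd p = j}) = fact (card {p \<in> V. snd p = j})"
      by simp
  qed
  finally show ?thesis by (simp add: card_cartesian_product mult.commute)
qed

text \<open>A row reaching a later column also reaches column c. So a strip of length k in the later
  columns blocks exactly k rows of column c, whatever its shape; this makes the column factor depend
  on k and h alone.\<close>

lemma card_strip_rows:
  assumes "V \<in> strips R n (Suc c) k"
  shows "fst ` V \<subseteq> R c" "card (fst ` V) = k"
proof -
  show "fst ` V \<subseteq> R c"
  proof clarsimp
    fix r j assume "(r, j) \<in> V"
    then have "r \<in> R j" "c \<le> j" using assms by (auto simp: strips_def)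
    then show "r \<in> R c" using R_antimono by blast
  qed
  show "card (fst ` V) = k"
    using assms by (simp add: strips_def card_image)
qed

text \<open>Once the part in later columns is fixed, the component in column c is any h-subset
  \<open>Q\<close> of the rows still free. The number of such subsets times h! is a falling
  factorial.\<close>

lemma strip_sum_column:
  assumes "c \<le> n"
  shows "(\<Sum>V\<in>strips R n c k. int (vstrip_fact V)) =
    (\<Sum>h\<le>k. (\<Sum>V\<in>strips R n (Suc c) (k - h). int (vstrip_fact V)) *
      ffall (int (card (R c)) - int (k - h)) h)"
proof -
  let ?Q = "\<lambda>h V. {Q. Q \<subseteq> R c - fst ` V \<and> card Q = h}"
  let ?T = "SIGMA h:{..k}. SIGMA V:strips R n (Suc c) (k - h). ?Q h V"
  have fin: "finite (?Q h V)" for h V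
    by (rule finite_subset[of _ "Pow (R c)"]) (use finite_R in auto)
  have "(\<Sum>V\<in>strips R n c k. int (vstrip_fact V)) =
      (\<Sum>(h, V, Q)\<in>?T. int (vstrip_fact V) * fact h)"
  proof (rule sum.reindex_bij_witness[where i = "\<lambda>(h, V, Q). V \<union> Q \<times> {c}"
        and j = "\<lambda>V. (card {p \<in> V. snd p = c}, {p \<in> V. snd p \<noteq> c}, fst ` {p \<in> V. snd p = c})"])
    fix V assume V: "V \<in> strips R n c k"
    let ?A = "{p \<in> V. snd p = c}" and ?B = "{p \<in> V. snd p \<noteq> c}"
    have finV: "finite V" by (rule finite_strip[OF V])
    have inj: "inj_on fst V" and sub: "V \<subseteq> {(r, j). j \<in> {c..n} \<and> r \<in> R j}" and card: "card V = k"
      using V by (auto simp: strips_def)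
    have "card V = card ?A + card ?B"
      using finV by (subst card_Un_disjoint[symmetric]) (auto intro: arg_cong[of _ _ card])
    then have k: "card ?A \<le> k" "card ?B = k - card ?A" using card by auto
    have A: "fst ` ?A \<times> {c} = ?A" by force
    have AB: "fst ` ?A \<inter> fst ` ?B = {}"
      using inj by (auto dest!: inj_onD)
    have cardA: "card (fst ` ?A) = card ?A"
      using inj by (intro card_image) (auto intro: inj_on_subset)
    have B: "?B \<in> strips R n (Suc c) (k - card ?A)"
      using sub k inj by (auto simp: strips_def intro: inj_on_subset)
    show "(case (card ?A, ?B, fst ` ?A) of (h, V, Q) \<Rightarrow> V \<union> Q \<times> {c}) = V"
      using A by auto
    have "fst ` ?A \<subseteq> R c" using sub by auto
    then show "(card ?A, ?B, fst ` ?A) \<in> ?T"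
      using B k AB cardA by auto
    have "vstrip_fact V = vstrip_fact (?B \<union> fst ` ?A \<times> {c})"
      by (rule arg_cong[of _ _ vstrip_fact]) (use A in auto)
    also have "\<dots> = vstrip_fact ?B * fact (card ?A)"
      using vstrip_fact_add_column[OF B, of "fst ` ?A"] finV cardA by simp
    finally show "(case (card ?A, ?B, fst ` ?A) of (h, V, Q) \<Rightarrow> int (vstrip_fact V) * fact h) =
        int (vstrip_fact V)"
      by simp
  next
    fix p assume "p \<in> ?T"
    then obtain h V Q where p: "p = (h, V, Q)" "h \<le> k" "V \<in> strips R n (Suc c) (k - h)"
      "Q \<subseteq> R c - fst ` V" "card Q = h" by auto
    have finV: "finite V" by (rule finite_strip[OF p(3)])
    have finQ: "finite Q" using p(4) finite_R[of c] by (meson finite_Diff finite_subset)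
    have Vc: "snd p \<noteq> c" if "p \<in> V" for p using that p(3) by (auto simp: strips_def)
    have "card (V \<union> Q \<times> {c}) = card V + card (Q \<times> {c})"
      using finV finQ Vc by (intro card_Un_disjoint) force+
    also have "\<dots> = k"
      using p by (simp add: card_cartesian_product strips_def)
    finally have card: "card (V \<union> Q \<times> {c}) = k" .
    have inj: "inj_on fst (V \<union> Q \<times> {c})"
      unfolding inj_on_Un
    proof (intro conjI)
      show "inj_on fst V" using p(3) by (simp add: strips_def)
      show "inj_on fst (Q \<times> {c})" by (auto simp: inj_on_def)
      show "fst ` (V - Q \<times> {c}) \<inter> fst ` (Q \<times> {c} - V) = {}"
        using p(4) by force
    qed
    have "V \<union> Q \<times> {c} \<subseteq> {(r, j). j \<in> {c..n} \<and> r \<in> R j}"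
      using p(3,4) assms by (auto simp: strips_def)
    then show "(case p of (h, V, Q) \<Rightarrow> V \<union> Q \<times> {c}) \<in> strips R n c k"
      using card inj p(1) by (simp add: strips_def)
    have 1: "{p \<in> V \<union> Q \<times> {c}. snd p = c} = Q \<times> {c}" "{p \<in> V \<union> Q \<times> {c}. snd p \<noteq> c} = V"
      using Vc by auto
    show "(card {q \<in> case p of (h, V, Q) \<Rightarrow> V \<union> Q \<times> {c}. snd q = c},
        {q \<in> case p of (h, V, Q) \<Rightarrow> V \<union> Q \<times> {c}. snd q \<noteq> c},
        fst ` {q \<in> case p of (h, V, Q) \<Rightarrow> V \<union> Q \<times> {c}. snd q = c}) = p"
      unfolding p(1) prod.case 1 using p(5) by (auto simp: card_cartesian_product)
  qed
  also have "\<dots> = (\<Sum>h\<le>k. \<Sum>V\<in>strips R n (Suc c) (k - h). \<Sum>Q\<in>?Q h V. int (vstrip_fact V) * fact h)"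
    by (simp add: sum.Sigma fin del: sum_constant)
  also have "\<dots> = (\<Sum>h\<le>k. \<Sum>V\<in>strips R n (Suc c) (k - h).
      int (vstrip_fact V) * ffall (int (card (R c)) - int (k - h)) h)"
  proof (intro sum.cong refl)
    fix h V assume h: "h \<in> {..k}" and V: "V \<in> strips R n (Suc c) (k - h)"
    note rows = card_strip_rows[OF V]
    have "card (?Q h V) = card (R c - fst ` V) choose h"
      by (rule n_subsets) (use finite_R in auto)
    also have "card (R c - fst ` V) = card (R c) - (k - h)"
      using rows finite_R[of c] finite_subset by (subst card_Diff_subset) auto
    finally have "int (card (?Q h V)) * fact h = ffall (int (card (R c) - (k - h))) h"
      by (simp add: ffall_eq_binomial_fact)
    \<comment> \<open>Needed to read the truncated difference as an integer difference.\<close>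
    moreover have "k - h \<le> card (R c)"
      using rows card_mono[OF finite_R rows(1)] by simp
    ultimately show "(\<Sum>Q\<in>?Q h V. int (vstrip_fact V) * fact h) =
        int (vstrip_fact V) * ffall (int (card (R c)) - int (k - h)) h"
      by (simp add: of_nat_diff algebra_simps)
  qed
  finally show ?thesis by (simp add: sum_distrib_right)
qed

lemma strip_sum_empty: "(\<Sum>V\<in>strips R n (Suc n) k. int (vstrip_fact V)) = (if k = 0 then 1 else 0)"
proof -
  have "strips R n (Suc n) k = (if k = 0 then {{}} else {})"
    by (auto simp: strips_def)
  then show ?thesis by (simp add: vstrip_fact_def)
qed

end

section \<open>Agreement of the three sums\<close>

lemma vertical_strips_eq_strips:
  assumes "part \<mu> 1 \<le> n" "is_partition \<mu>"
  shows "vertical_strips \<mu> k = strips (\<lambda>j. {r \<in> {1..length \<mu>}. j \<le> part \<mu> r}) n 1 k"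
proof -
  have "part \<mu> r \<le> n" if "r \<in> {1..length \<mu>}" for r
  proof (cases "r = 1")
    case False
    have "sorted_wrt (\<ge>) \<mu>" using assms by (simp add: is_partition_def)
    then have "\<mu> ! (r - 1) \<le> \<mu> ! 0"
      using False that by (intro sorted_wrt_nth_less[of "(\<ge>)" \<mu>]) auto
    moreover have "\<mu> ! 0 = part \<mu> 1" using that by (auto simp: part_def)
    moreover have "part \<mu> r = \<mu> ! (r - 1)" using that by (simp add: part_def)
    ultimately show ?thesis using assms(1) by linarith
  qed (use assms in simp)
  then have "ferrers \<mu> = {(r, j). j \<in> {1..n} \<and> r \<in> {r \<in> {1..length \<mu>}. j \<le> part \<mu> r}}"
    by (force simp: ferrers_def)
  then show ?thesis by (simp add: vertical_strips_def strips_def)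
qed

text \<open>The first equation is the closed formula for the eigenvalue; the second has the shape in
  which the eigenvalue comes out of the algebra.\<close>

lemma hstar_formulas:
  assumes "part \<mu> 1 \<le> n" "is_partition \<mu>"
  shows hstar_eq_list_sum: "int (hstar \<mu> k) = list_sum (\<lambda>i. int (conjugate \<mu> i)) n 1 k"
    and hstar_eq_comp_sum:
      "int (hstar \<mu> k) = (\<Sum>h\<in>compositions n 1 k. comp_prod (\<lambda>i. int (conjugate \<mu> i)) n 1 h)"
proof -
  let ?R = "\<lambda>j. {r \<in> {1..length \<mu>}. j \<le> part \<mu> r}" and ?l = "\<lambda>i. int (conjugate \<mu> i)"
  have R: "\<And>j. finite (?R j)" "\<And>i j. i \<le> j \<Longrightarrow> ?R j \<subseteq> ?R i" by auto
  have hstar: "int (hstar \<mu> k) = (\<Sum>V\<in>strips ?R n 1 k. int (vstrip_fact V))"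
    by (simp add: hstar_def vertical_strips_eq_strips[OF assms])
  have rec: "(\<Sum>V\<in>strips ?R n c k. int (vstrip_fact V)) =
    (\<Sum>h\<le>k. (\<Sum>V\<in>strips ?R n (Suc c) (k - h). int (vstrip_fact V)) *
      ffall (?l c - int (k - h)) h)" if "c \<le> n" for c k
    using strip_sum_column[of ?R, OF R that] by (simp add: conjugate_def)
  show "int (hstar \<mu> k) = list_sum ?l n 1 k"
    unfolding hstar
    by (rule column_recursion_unique[of "\<lambda>c k. \<Sum>V\<in>strips ?R n c k. int (vstrip_fact V)" n
        "\<lambda>c k. list_sum ?l n c k" "\<lambda>c k h. ffall (?l c - int (k - h)) h" 1 k])
      (simp_all only: rec list_sum_column list_sum_empty strip_sum_empty[of ?R, OF R])
  show "int (hstar \<mu> k) = (\<Sum>h\<in>compositions n 1 k. comp_prod ?l n 1 h)"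
    unfolding hstar
    by (rule column_recursion_unique[of "\<lambda>c k. \<Sum>V\<in>strips ?R n c k. int (vstrip_fact V)" n
        "\<lambda>c k. \<Sum>h\<in>compositions n c k. comp_prod ?l n c h" "\<lambda>c k h. ffall (?l c - int (k - h)) h" 1 k])
      (simp_all only: rec comp_prod_column compositions_empty strip_sum_empty[of ?R, OF R])
qed

text \<open>The cells of a strip occupy distinct rows, and the number of rows is the length of the
  first column.\<close>

lemma hstar_eq_0:
  assumes "conjugate \<mu> 1 < k"
  shows "hstar \<mu> k = 0"
proof -
  have "vertical_strips \<mu> k = {}"
  proof (rule ccontr)
    assume "vertical_strips \<mu> k \<noteq> {}"
    then obtain V where V: "V \<subseteq> ferrers \<mu>" "card V = k" "inj_on fst V"
      by (auto simp: vertical_strips_def)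
    have "fst ` V \<subseteq> {r \<in> {1..length \<mu>}. 1 \<le> part \<mu> r}"
      using V(1) by (force simp: ferrers_def)
    then have "card (fst ` V) \<le> conjugate \<mu> 1"
      unfolding conjugate_def by (intro card_mono) auto
    then show False using V assms by (simp add: card_image)
  qed
  then show ?thesis by (simp add: hstar_def)
qed

lemma conjugate_antimono: "i \<le> j \<Longrightarrow> conjugate \<mu> j \<le> conjugate \<mu> i"
  unfolding conjugate_def by (intro card_mono) auto

lemma conjugate_le_length: "conjugate \<mu> i \<le> length \<mu>"
  unfolding conjugate_def by (rule order_trans[OF card_mono[of "{1..length \<mu>}"]]) auto

section \<open>Virtual weights and the virtual projection\<close>

text \<open>The eigenvalue of $e_{a,b}$ under the commutator with $e_{\<gamma>,\<gamma>}$, recorded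
  for non-proper $\<gamma>$ only.\<close>

definition letter_weight :: "letter \<Rightarrow> symbol \<Rightarrow> int" where
  "letter_weight = (\<lambda>(a, b) \<gamma>.
    if \<gamma> \<in> range Proper then 0 else of_bool (a = \<gamma>) - of_bool (b = \<gamma>))"

definition weight :: "letter list \<Rightarrow> symbol \<Rightarrow> int" where
  "weight w \<gamma> = (\<Sum>l\<leftarrow>w. letter_weight l \<gamma>)"

lemma weight_simps [simp]:
  "weight [] = 0"
  "weight (l # w) = letter_weight l + weight w"
  "weight (u @ w) = weight u + weight w"
  by (simp_all add: weight_def fun_eq_iff)

text \<open>Contracting $e_{a,b} e_{b,c}$ to $e_{a,c}$ preserves the weight, so commutation
  relations are homogeneous.\<close>

lemma letter_weight_trans: "letter_weight (a, b) + letter_weight (b, c) = letter_weight (a, c)"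
  by (auto simp: letter_weight_def fun_eq_iff)

definition virtuals :: "nat \<Rightarrow> nat \<Rightarrow> symbol set" where
  "virtuals m0 m1 = sym_A0 m0 \<union> sym_A1 m1"

lemma symbols_eq: "symbols m0 m1 n = virtuals m0 m1 \<union> sym_L n"
  by (simp add: symbols_def virtuals_def)

lemma virtuals_not_Proper: "\<gamma> \<in> virtuals m0 m1 \<Longrightarrow> \<gamma> \<notin> range Proper"
  by (auto simp: virtuals_def sym_A0_def sym_A1_def)

lemma sym_L_Proper: "a \<in> sym_L n \<Longrightarrow> a \<in> range Proper"
  by (auto simp: sym_L_def)

lemma virtuals_sym_L_disjoint: "\<gamma> \<in> virtuals m0 m1 \<Longrightarrow> \<gamma> \<notin> sym_L n"
  using virtuals_not_Proper sym_L_Proper by blast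

text \<open>Every letter adds 1 at its own virtual symbol and subtracts nothing, so contributions
  cannot cancel.\<close>

lemma weight_lowering:
  assumes "set X \<subseteq> virtuals m0 m1 \<times> sym_L n"
  shows "weight X \<gamma> \<ge> 0" and "weight X = 0 \<Longrightarrow> X = []"
proof -
  have nonneg: "weight X \<gamma> \<ge> 0" if "set X \<subseteq> virtuals m0 m1 \<times> sym_L n" for X \<gamma>
    using that
  proof (induction X)
    case (Cons l X)
    then have "letter_weight l \<gamma> \<ge> 0"
      using sym_L_Proper by (fastforce simp: letter_weight_def)
    then show ?case using Cons by auto
  qed simp
  show "weight X \<gamma> \<ge> 0" by (rule nonneg[OF assms])
  show "X = []" if "weight X = 0"
  proof (cases X)
    case (Cons l X')
    obtain a b where l: "l = (a, b)" "a \<in> virtuals m0 m1" "b \<in> sym_L n"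
      using Cons assms by auto
    have "a \<noteq> b" using l virtuals_sym_L_disjoint by blast
    then have "letter_weight l a = 1"
      using l virtuals_not_Proper[of a] by (simp add: letter_weight_def)
    moreover have "weight X' a \<ge> 0" using Cons assms by (intro nonneg) auto
    moreover have "weight X a = 0" using that by simp
    ultimately show ?thesis unfolding Cons by simp
  qed
qed

lemma weight_proper: "set Y \<subseteq> sym_L n \<times> sym_L n \<Longrightarrow> weight Y = 0"
proof (induction Y)
  case (Cons l Y)
  then have "letter_weight l = 0"
    using sym_L_Proper by (fastforce simp: letter_weight_def fun_eq_iff)
  then show ?case using Cons by simp
qed simp

lemma gen_const_mult: "gen a b * (const c * x) = const c * (gen a b * x)"
  unfolding mult.assoc[symmetric] const_commute[of c "gen a b"] ..

text \<open>
  Modulo the left ideal generated by the $e_{a,\gamma}$, $\gamma$ virtual, every word is a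
  combination of words in the $e_{\gamma,i}$ followed by a word in the $e_{i,j}$, of the same
  weight. Hence words with a negative weight lie in the ideal, and words of weight zero are
  congruent to elements of $\mathbf{U}(gl(n))$.
\<close>

locale virtual_left_ideal =
  fixes m0 m1 n :: nat and J :: "tensor set"
  assumes J_zero: "0 \<in> J"
    and J_add: "x \<in> J \<Longrightarrow> y \<in> J \<Longrightarrow> x + y \<in> J"
    and J_mult: "x \<in> tensors (symbols m0 m1 n) \<Longrightarrow> y \<in> J \<Longrightarrow> x * y \<in> J"
    and J_enveloping: "enveloping_ideal (symbols m0 m1 n) \<subseteq> J"
    and J_gen: "a \<in> symbols m0 m1 n \<Longrightarrow> \<gamma> \<in> virtuals m0 m1 \<Longrightarrow> gen a \<gamma> \<in> J"
begin

abbreviation "S \<equiv> symbols m0 m1 n"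

text \<open>All of \<open>J\<close> belongs to every weight, so \<omega> constrains only the ordered
  words that survive modulo \<open>J\<close>.\<close>

inductive_set normal_forms :: "(symbol \<Rightarrow> int) \<Rightarrow> tensor set" for \<omega> where
  ideal: "x \<in> J \<Longrightarrow> x \<in> normal_forms \<omega>"
| word: "set X \<subseteq> virtuals m0 m1 \<times> sym_L n \<Longrightarrow> set Y \<subseteq> sym_L n \<times> sym_L n \<Longrightarrow> weight X = \<omega> \<Longrightarrow>
    const c * word (X @ Y) \<in> normal_forms \<omega>"
| add: "x \<in> normal_forms \<omega> \<Longrightarrow> y \<in> normal_forms \<omega> \<Longrightarrow> x + y \<in> normal_forms \<omega>"

lemma normal_forms_word:
  "set X \<subseteq> virtuals m0 m1 \<times> sym_L n \<Longrightarrow> set Y \<subseteq> sym_L n \<times> sym_L n \<Longrightarrow>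
    word (X @ Y) \<in> normal_forms (weight X)"
  using normal_forms.word[of X Y "weight X" 1] by simp

lemma normal_forms_const: "x \<in> normal_forms \<omega> \<Longrightarrow> const c * x \<in> normal_forms \<omega>"
proof (induction rule: normal_forms.induct)
  case (ideal x)
  then show ?case by (intro normal_forms.ideal J_mult) auto
next
  case (word X Y d)
  then show ?case
    using normal_forms.word[OF word, of "c * d"] by (simp add: const_mult mult.assoc del: mult_single)
next
  case (add x y)
  then show ?case by (simp add: distrib_left normal_forms.add)
qed

lemma gl_rel_mult_in_J:
  assumes "a \<in> S" "b \<in> S" "c \<in> S" "d \<in> S" "x \<in> tensors S"
  shows "gl_rel a b c d * x \<in> J"
  using enveloping_ideal_mult_right[OF gl_rel_in_enveloping_ideal[OF assms(1-4)] assms(5)]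
    J_enveloping by blast

text \<open>The relation is solved for one product and written as a pure sum, with signs inside
  \<open>const\<close>, so that closure under addition and scalars applies directly.\<close>

lemma gen_gen_mult:
  "gen a b * (gen c d * x) = const (sgn_sym a b c d) * (gen c d * (gen a b * x)) +
    const (if b = c then 1 else 0) * (gen a d * x) +
    const (- (sgn_sym a b c d * (if a = d then 1 else 0))) * (gen c b * x) +
    gl_rel a b c d * x"
  unfolding gl_rel_eq by (simp add: algebra_simps single_uminus)

text \<open>Moving $e_{a,\<gamma>}$ to the right through proper letters, the only contraction gives
  $e_{i,\<gamma>}$, again with second index $\<gamma>$; hence the induction over all a.\<close>

lemma gen_virtual_proper_word_in_J:
  assumes "\<gamma> \<in> virtuals m0 m1" "set Y \<subseteq> sym_L n \<times> sym_L n" "a \<in> S"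
  shows "gen a \<gamma> * word Y \<in> J"
  using assms(2,3)
proof (induction Y arbitrary: a)
  case Nil
  then show ?case using J_gen assms(1) by simp
next
  case (Cons l Y)
  obtain i j where l: "l = (i, j)" "i \<in> sym_L n" "j \<in> sym_L n" using Cons.prems by auto
  have S: "i \<in> S" "j \<in> S" "\<gamma> \<in> S" using l assms(1) by (auto simp: symbols_eq)
  have "word Y \<in> tensors S" using Cons.prems by (intro tensors_word) (auto simp: symbols_eq)
  then have "gl_rel a \<gamma> i j * word Y \<in> J"
    using S Cons.prems by (intro gl_rel_mult_in_J) auto
  moreover have "gen a \<gamma> * word Y \<in> J" "gen i \<gamma> * word Y \<in> J" using Cons S by auto
  moreover have "\<gamma> \<noteq> i" using l assms(1) virtuals_sym_L_disjoint by blast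
  ultimately show ?case
    using S unfolding l word_Cons
    by (subst gen_gen_mult) (auto intro!: J_add J_mult tensors_gen)
qed

lemma gen_mult_normal_forms:
  assumes "x \<in> normal_forms \<omega>" "\<gamma> \<in> virtuals m0 m1" "i \<in> sym_L n"
  shows "gen \<gamma> i * x \<in> normal_forms (letter_weight (\<gamma>, i) + \<omega>)"
  using assms(1)
proof (induction rule: normal_forms.induct)
  case (ideal x)
  then show ?case
    using assms by (intro normal_forms.ideal J_mult tensors_gen) (auto simp: symbols_eq)
next
  case (word X Y c)
  have "const c * word (((\<gamma>, i) # X) @ Y) \<in> normal_forms (letter_weight (\<gamma>, i) + \<omega>)"
    using word assms by (intro normal_forms.word) auto
  then show ?case
    by (simp add: word_Cons gen_const_mult del: plus_fun_apply)
next
  case (add x y)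
  then show ?case by (simp add: distrib_left normal_forms.add)
qed

text \<open>The new letter is commuted past the first letter of X. Each of the three resulting terms
  applies some letter to the shorter word, so the induction must allow all a and b; weights match by
  \<open>letter_weight_trans\<close>.\<close>

lemma gen_mult_word_normal_forms:
  assumes "a \<in> S" "b \<in> S" "set X \<subseteq> virtuals m0 m1 \<times> sym_L n" "set Y \<subseteq> sym_L n \<times> sym_L n"
  shows "gen a b * word (X @ Y) \<in> normal_forms (letter_weight (a, b) + weight X)"
  using assms(1-3)
proof (induction X arbitrary: a b)
  case Nil
  consider "b \<in> virtuals m0 m1" | "a \<in> virtuals m0 m1" "b \<in> sym_L n" | "a \<in> sym_L n" "b \<in> sym_L n"
    using Nil by (auto simp: symbols_eq)
  then show ?case
  proof cases
    case 1
    then show ?thesis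
      using gen_virtual_proper_word_in_J[OF 1 assms(4)] Nil by (auto intro: normal_forms.ideal)
  next
    case 2
    then show ?thesis
      using normal_forms_word[of "[(a, b)]" Y] assms(4) by (simp add: word_Cons)
  next
    case 3
    then have "letter_weight (a, b) = 0" using weight_proper[of "[(a, b)]" n] by simp
    with 3 show ?thesis
      using normal_forms_word[of "[]" "(a, b) # Y"] assms(4)
      by (simp add: word_Cons del: zero_fun_apply plus_fun_apply)
  qed
next
  case (Cons l X)
  obtain \<gamma> i where l: "l = (\<gamma>, i)" "\<gamma> \<in> virtuals m0 m1" "i \<in> sym_L n" using Cons.prems by auto
  have S: "a \<in> S" "b \<in> S" "\<gamma> \<in> S" "i \<in> S" using l Cons.prems by (auto simp: symbols_eq)
  have X: "set X \<subseteq> virtuals m0 m1 \<times> sym_L n" using Cons.prems by simp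
  let ?w = "word (X @ Y)" and ?\<omega> = "letter_weight (a, b) + (letter_weight (\<gamma>, i) + weight X)"
  have IH: "gen c d * ?w \<in> normal_forms (letter_weight (c, d) + weight X)" if "c \<in> S" "d \<in> S" for c d
    using Cons.IH[OF that X] .
  have "?w \<in> tensors S" using X assms(4) by (intro tensors_word) (auto simp: symbols_eq)
  then have 1: "gl_rel a b \<gamma> i * ?w \<in> normal_forms ?\<omega>"
    using S by (intro normal_forms.ideal gl_rel_mult_in_J)
  have 2: "gen \<gamma> i * (gen a b * ?w) \<in> normal_forms ?\<omega>"
    using gen_mult_normal_forms[OF IH[OF S(1,2)] l(2,3)] by (simp add: ac_simps)
  have 3: "const (if b = \<gamma> then 1 else 0) * (gen a i * ?w) \<in> normal_forms ?\<omega>"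
  proof (cases "b = \<gamma>")
    case True
    then have eq: "?\<omega> = letter_weight (a, i) + weight X"
      by (simp flip: letter_weight_trans[of a \<gamma> i] add: ac_simps)
    show ?thesis unfolding eq using IH[OF S(1,4)] True by simp
  qed (simp add: normal_forms.ideal J_zero)
  have 4: "const (- (sgn_sym a b \<gamma> i * (if a = i then 1 else 0))) * (gen \<gamma> b * ?w) \<in> normal_forms ?\<omega>"
  proof (cases "a = i")
    case True
    then have eq: "?\<omega> = letter_weight (\<gamma>, b) + weight X"
      by (simp flip: letter_weight_trans[of \<gamma> i b] add: ac_simps)
    show ?thesis unfolding eq using normal_forms_const[OF IH[OF S(3,2)]] True by simp
  qed (simp add: normal_forms.ideal J_zero)
  have "gen a b * (gen \<gamma> i * ?w) \<in> normal_forms ?\<omega>"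
    by (subst gen_gen_mult) (intro normal_forms.add normal_forms_const 1 2 3 4)
  then show ?case by (simp add: l word_Cons del: plus_fun_apply)
qed

lemma word_normal_forms:
  assumes "set w \<subseteq> S \<times> S"
  shows "word w \<in> normal_forms (weight w)"
  using assms
proof (induction w)
  case Nil
  then show ?case using normal_forms_word[of "[]" "[]"] by (simp del: zero_fun_apply)
next
  case (Cons l w)
  obtain a b where l: "l = (a, b)" "a \<in> S" "b \<in> S" using Cons.prems by auto
  have "gen a b * x \<in> normal_forms (letter_weight (a, b) + \<omega>)" if "x \<in> normal_forms \<omega>" for x \<omega>
    using that
  proof (induction rule: normal_forms.induct)
    case (ideal x)
    then show ?case using l by (intro normal_forms.ideal J_mult tensors_gen)
  next
    case (word X Y c)
    then have "const c * (gen a b * word (X @ Y)) \<in> normal_forms (letter_weight (a, b) + \<omega>)"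
      using gen_mult_word_normal_forms[OF l(2,3)] normal_forms_const by blast
    then show ?case unfolding gen_const_mult .
  next
    case (add x y)
    then show ?case by (simp add: distrib_left normal_forms.add)
  qed
  then show ?case using Cons l by (simp add: word_Cons del: plus_fun_apply)
qed

lemma word_negative_weight_in_J:
  assumes "set w \<subseteq> S \<times> S" "weight w \<gamma> < 0"
  shows "word w \<in> J"
proof -
  have "x \<in> J" if "x \<in> normal_forms \<omega>" "\<omega> \<gamma> < 0" for x \<omega>
    using that
  proof (induction rule: normal_forms.induct)
    case (word X Y c)
    then show ?case using weight_lowering(1)[of X m0 m1 n \<gamma>] by simp
  qed (auto intro: J_add)
  then show ?thesis using word_normal_forms assms by blast
qed

lemma word_zero_weight:
  assumes "set w \<subseteq> S \<times> S" "weight w = 0"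
  obtains x where "x \<in> tensors (sym_L n)" "word w - x \<in> J"
proof -
  have "\<exists>y\<in>tensors (sym_L n). x - y \<in> J" if "x \<in> normal_forms 0" for x
    using that
  proof (induction rule: normal_forms.induct)
    case (word X Y c)
    then have "X = []" using weight_lowering(2) by blast
    then show ?case
      using word J_zero by (intro bexI[of _ "const c * word Y"] tensors_mult tensors_word) auto
  next
    case (add x y)
    then obtain x' y' where "x' \<in> tensors (sym_L n)" "y' \<in> tensors (sym_L n)"
      "x - x' \<in> J" "y - y' \<in> J" by auto
    then show ?case
      using J_add[of "x - x'" "y - y'"]
      by (intro bexI[of _ "x' + y'"]) (auto simp: algebra_simps)
  qed (auto intro!: bexI[of _ 0])
  then show ?thesis using word_normal_forms[OF assms(1)] assms(2) that by auto
qed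

end

section \<open>The ideal of irregular products and its action on a vacuum vector\<close>

lemma left_ideal_Irr:
  "u \<in> Irr m0 m1 n \<Longrightarrow> u' \<in> Irr m0 m1 n \<Longrightarrow> u \<oplus>\<^bsub>UEA (symbols m0 m1 n)\<^esub> u' \<in> Irr m0 m1 n"
  "\<zero>\<^bsub>UEA (symbols m0 m1 n)\<^esub> \<in> Irr m0 m1 n"
  "r \<in> carrier (UEA (symbols m0 m1 n)) \<Longrightarrow> u \<in> Irr m0 m1 n \<Longrightarrow>
    r \<otimes>\<^bsub>UEA (symbols m0 m1 n)\<^esub> u \<in> Irr m0 m1 n"
  unfolding Irr_def left_ideal_generated_def left_ideal_def
  by (auto simp: additive_subgroup.a_closed additive_subgroup.zero_closed)

text \<open>At i = 1 the symbol $\<gamma>$ has been used once and never created. Thus the generators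
  required in \<open>J_gen\<close> lie in \<open>Irr\<close>.\<close>

lemma irregular_letter:
  assumes "\<gamma> \<in> virtuals m0 m1"
  shows "irregular m0 m1 [(a, \<gamma>)]"
proof -
  have "{j \<in> {1..1}. snd (rev [(a, \<gamma>)] ! (j - 1)) = \<gamma>} = {1}" by auto
  then show ?thesis
    using assms unfolding irregular_def virtuals_def
    by (intro bexI[of _ 1] bexI[of _ \<gamma>]) auto
qed

text \<open>This instance yields the decomposition behind the projection: words of weight zero are
  congruent modulo \<open>Irr\<close> to tensors over L.\<close>

lemma virtual_left_ideal_Irr:
  "virtual_left_ideal m0 m1 n {x \<in> tensors (symbols m0 m1 n). cls (symbols m0 m1 n) x \<in> Irr m0 m1 n}"
proof unfold_locales
  let ?S = "symbols m0 m1 n"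
  show "enveloping_ideal ?S \<subseteq> {x \<in> tensors ?S. cls ?S x \<in> Irr m0 m1 n}"
  proof
    fix x assume x: "x \<in> enveloping_ideal ?S"
    then have "x \<in> tensors ?S" using enveloping_ideal_subset by blast
    moreover from this have "cls ?S x = cls ?S 0" using x by (subst cls_eq_iff) auto
    ultimately show "x \<in> {x \<in> tensors ?S. cls ?S x \<in> Irr m0 m1 n}"
      by (simp add: cls_zero left_ideal_Irr)
  qed
  fix a \<gamma> assume a: "a \<in> ?S" "\<gamma> \<in> virtuals m0 m1"
  then have \<gamma>: "\<gamma> \<in> ?S" by (auto simp: symbols_eq)
  have "set [(a, \<gamma>)] \<subseteq> ?S \<times> ?S" using a \<gamma> by simp
  then have "monomial ?S [(a, \<gamma>)] \<in> Irr m0 m1 n"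
    unfolding Irr_def left_ideal_generated_def using irregular_letter[OF a(2), of a] by blast
  then show "gen a \<gamma> \<in> {x \<in> tensors ?S. cls ?S x \<in> Irr m0 m1 n}"
    using a \<gamma> by (simp add: monomial_eq_cls gen_eq_word tensors_word)
qed (auto simp: cls_zero cls_add cls_mult cls_carrier left_ideal_Irr)

locale virtual_vacuum = super_rep smul "symbols m0 m1 n" E
  for smul :: "complex \<Rightarrow> 'v::ab_group_add \<Rightarrow> 'v" and m0 m1 n :: nat and E +
  fixes v :: 'v
  assumes vacuum: "a \<in> symbols m0 m1 n \<Longrightarrow> \<gamma> \<in> virtuals m0 m1 \<Longrightarrow> E a \<gamma> v = 0"
begin

abbreviation "S \<equiv> symbols m0 m1 n"

text \<open>This instance turns membership in \<open>J\<close> into vanishing on \<open>v\<close>,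
  and so shows that words of negative weight kill the vacuum.\<close>

lemma virtual_left_ideal_annihilator:
  "virtual_left_ideal m0 m1 n {x \<in> tensors S. act x v = 0}"
  by unfold_locales
    (auto simp: act_add act_mult act_vec_zero act_enveloping_ideal vacuum symbols_eq
      dest: subsetD[OF enveloping_ideal_subset])

text \<open>$e_{\<gamma>,\<gamma>}$ is even, so it commutes past each letter without sign and adds
  that letter's weight; on the vacuum it gives 0.\<close>

lemma E_weight:
  assumes "set w \<subseteq> S \<times> S" "\<gamma> \<in> virtuals m0 m1"
  shows "E \<gamma> \<gamma> (word_act E w v) = smul (of_int (weight w \<gamma>)) (word_act E w v)"
  using assms(1)
proof (induction w)
  case Nil
  then show ?case using vacuum[of \<gamma> \<gamma>] assms(2) by (simp add: symbols_eq)
next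
  case (Cons l w)
  obtain c d where l: "l = (c, d)" "c \<in> S" "d \<in> S" using Cons.prems by auto
  let ?x = "word_act E w v"
  have \<gamma>: "\<gamma> \<in> S" using assms(2) by (auto simp: symbols_eq)
  have "E \<gamma> \<gamma> (E c d ?x) = E c d (E \<gamma> \<gamma> ?x) + (if \<gamma> = c then E c d ?x else 0)
      - (if \<gamma> = d then E c d ?x else 0)"
    using E_rel[of \<gamma> \<gamma> c d ?x] \<gamma> l
    by (cases "\<gamma> = c"; cases "\<gamma> = d") (auto simp: sgn_sym_def algebra_simps)
  also have "E c d (E \<gamma> \<gamma> ?x) = smul (of_int (weight w \<gamma>)) (E c d ?x)"
    using Cons l by (simp add: E_scale)
  finally show ?case
    using virtuals_not_Proper[OF assms(2)]
    by (auto simp: l letter_weight_def scale_left_distrib scale_left_diff_distrib)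
qed

lemma negative_weight_act:
  assumes "set w \<subseteq> S \<times> S" "weight w \<gamma> < 0"
  shows "word_act E w v = 0"
  using virtual_left_ideal.word_negative_weight_in_J[OF virtual_left_ideal_annihilator assms] by simp

lemma card_letters_Cons:
  "card {j \<in> {1..length (l # w)}. f (rev (l # w) ! (j - 1)) = \<gamma>} =
    of_bool (f l = \<gamma>) + card {j \<in> {1..length w}. f (rev w ! (j - 1)) = \<gamma>}"
proof -
  have "{j \<in> {1..length (l # w)}. f (rev (l # w) ! (j - 1)) = \<gamma>} =
      {j \<in> {1..length w}. f (rev w ! (j - 1)) = \<gamma>} \<union> (if f l = \<gamma> then {Suc (length w)} else {})"
    by (auto simp: nth_append le_Suc_eq)
  then show ?thesis by (auto simp: card_Un_disjoint)
qed

lemma weight_eq_card: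
  assumes "\<gamma> \<notin> range Proper"
  shows "weight w \<gamma> = int (card {j \<in> {1..length w}. fst (rev w ! (j - 1)) = \<gamma>}) -
    int (card {j \<in> {1..length w}. snd (rev w ! (j - 1)) = \<gamma>})"
proof (induction w)
  case (Cons l w)
  obtain a b where "l = (a, b)" by fastforce
  then show ?case
    unfolding card_letters_Cons using Cons assms by (simp add: letter_weight_def)
qed simp

lemma irregular_act:
  assumes w: "set w \<subseteq> S \<times> S" and "irregular m0 m1 w"
  shows "word_act E w v = 0"
proof -
  obtain i \<gamma> where i: "i \<in> {1..length w}" and \<gamma>: "\<gamma> \<in> virtuals m0 m1"
    and irr: "card {j \<in> {1..i}. snd (rev w ! (j - 1)) = \<gamma>} > card {j \<in> {1..<i}. fst (rev w ! (j - 1)) = \<gamma>}"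
    using assms(2) unfolding irregular_def virtuals_def by blast
  have Proper: "\<gamma> \<notin> range Proper" by (rule virtuals_not_Proper[OF \<gamma>])
  \<comment> \<open>The first i factors from the right; \<open>l\<close> is the i-th factor and
    \<open>t'\<close> the product of those before it.\<close>
  define t where "t = drop (length w - i) w"
  obtain l t' where t: "t = l # t'" using i by (cases t) (auto simp: t_def)
  obtain a b where l: "l = (a, b)" by fastforce
  have len: "length t = i" "length t' = i - 1"
  proof -
    show "length t = i" using i by (simp add: t_def)
    then show "length t' = i - 1" using t by simp
  qed
  have w_eq: "w = take (length w - i) w @ t" by (simp add: t_def)
  have rev_t: "rev w ! (j - 1) = rev t ! (j - 1)" if "j \<in> {1..i}" for j
  proof -
    have "rev w ! (j - 1) = (rev t @ rev (take (length w - i) w)) ! (j - 1)"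
      using w_eq by (metis rev_append)
    moreover have "j - 1 < length (rev t)" using that len by auto
    ultimately show ?thesis by (simp add: nth_append)
  qed
  have rev_t': "rev w ! (j - 1) = rev t' ! (j - 1)" if "j \<in> {1..<i}" for j
  proof -
    have "rev w ! (j - 1) = (rev t' @ [l]) ! (j - 1)" using rev_t[of j] that t by simp
    moreover have "j - 1 < length (rev t')" using that len by auto
    ultimately show ?thesis by (simp add: nth_append)
  qed
  have "{j \<in> {1..i}. snd (rev w ! (j - 1)) = \<gamma>} = {j \<in> {1..length t}. snd (rev t ! (j - 1)) = \<gamma>}"
    using rev_t len by auto
  moreover have "{j \<in> {1..<i}. fst (rev w ! (j - 1)) = \<gamma>} = {j \<in> {1..length t'}. fst (rev t' ! (j - 1)) = \<gamma>}"
    using rev_t' len i by auto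
  ultimately have "card {j \<in> {1..length t'}. fst (rev t' ! (j - 1)) = \<gamma>} <
      card {j \<in> {1..length t}. snd (rev t ! (j - 1)) = \<gamma>}"
    using irr by simp
  \<comment> \<open>Irregularity counts second indices up to factor i but first indices only before
    it. Hence the weight of \<open>t\<close> is negative except possibly when factor i itself
    creates $\<gamma>$.\<close>
  then have lt: "weight t \<gamma> < of_bool (a = \<gamma>)"
    unfolding weight_eq_card[OF Proper] using card_letters_Cons[of l t' fst \<gamma>] by (simp add: t l)
  have t_S: "set t \<subseteq> S \<times> S" using w w_eq by (metis le_sup_iff set_append)
  have t'_S: "set t' \<subseteq> S \<times> S" and ab: "a \<in> S" "b \<in> S" using t_S t l by auto
  have "word_act E t v = 0"
  proof (cases "weight t \<gamma> < 0")
    case True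
    then show ?thesis using negative_weight_act[OF t_S] by simp
  next
    case False
    then have a: "a = \<gamma>" using lt by (cases "a = \<gamma>") auto
    then have "weight t \<gamma> = 0" using lt False by simp
    \<comment> \<open>In the exceptional case \<open>t'\<close> has weight 0 if $b = \<gamma>$, so
      that $e_{\<gamma>,\<gamma>}$ multiplies by 0, and weight -1 otherwise, so that
      \<open>t'\<close> already kills the vacuum.\<close>
    then have t': "weight t' \<gamma> = - of_bool (b \<noteq> \<gamma>)"
      using Proper a by (auto simp: t l letter_weight_def)
    show ?thesis
    proof (cases "b = \<gamma>")
      case True
      then show ?thesis using E_weight[OF t'_S \<gamma>] t' a by (simp add: t l)
    next
      case False
      then have "word_act E t' v = 0" using t' by (intro negative_weight_act[OF t'_S, of \<gamma>]) simp
      then show ?thesis using E_zero ab by (simp add: t l)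
    qed
  qed
  moreover have "set (take (length w - i) w) \<subseteq> S \<times> S" using w set_take_subset by (rule order_trans[rotated])
  ultimately show ?thesis
    by (subst w_eq) (simp add: word_act_zero)
qed

text \<open>The classes of tensors killing \<open>v\<close> form a left ideal of the enveloping
  algebra that contains the irregular monomials, hence contains \<open>Irr\<close>.\<close>

lemma Irr_annihilates:
  assumes "u \<in> Irr m0 m1 n"
  obtains x where "x \<in> tensors S" "u = cls S x" "act x v = 0"
proof -
  let ?K = "cls S ` {x \<in> tensors S. act x v = 0}"
  interpret U: ring "UEA S" by (rule ring_UEA)
  have "additive_subgroup ?K (UEA S)"
  proof (rule additive_subgroupI, rule U.add.subgroupI)
    show "?K \<subseteq> carrier (UEA S)" by (auto simp: cls_carrier)
    show "?K \<noteq> {}" by (auto intro!: exI[of _ 0])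
    fix y assume "y \<in> ?K"
    then obtain x where x: "x \<in> tensors S" "act x v = 0" "y = cls S x" by auto
    have "cls S (- x) \<oplus>\<^bsub>UEA S\<^esub> cls S x = \<zero>\<^bsub>UEA S\<^esub>"
      using cls_add[of "- x" S x] x by (simp add: tensors_uminus cls_zero)
    then have "\<ominus>\<^bsub>UEA S\<^esub> cls S x = cls S (- x)"
      using x by (intro U.minus_equality) (auto simp: cls_carrier tensors_uminus)
    then show "\<ominus>\<^bsub>UEA S\<^esub> y \<in> ?K"
      using x by (auto simp: act_uminus tensors_uminus)
  next
    fix y z assume "y \<in> ?K" "z \<in> ?K"
    then show "y \<oplus>\<^bsub>UEA S\<^esub> z \<in> ?K"
      by (auto simp: act_add tensors_add simp flip: cls_add)
  qed
  moreover have "r \<otimes>\<^bsub>UEA S\<^esub> y \<in> ?K" if r: "r \<in> carrier (UEA S)" and "y \<in> ?K" for r y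
  proof -
    obtain z where "z \<in> tensors S" "r = cls S z" by (rule carrier_UEA_E[OF r])
    with \<open>y \<in> ?K\<close> show ?thesis
      by (auto simp: act_mult act_vec_zero tensors_mult simp flip: cls_mult)
  qed
  ultimately have "left_ideal ?K (UEA S)"
    by (simp add: left_ideal_def)
  moreover have "{monomial S w | w. set w \<subseteq> S \<times> S \<and> irregular m0 m1 w} \<subseteq> ?K"
    by (auto simp: monomial_eq_cls irregular_act tensors_word)
  ultimately have "u \<in> ?K"
    using assms by (auto simp: Irr_def left_ideal_generated_def)
  then show ?thesis using that by auto
qed

end

lemma virtual_proj_monomial:
  assumes "set w \<subseteq> symbols m0 m1 n \<times> symbols m0 m1 n" "weight w = 0"
  obtains x y where "x \<in> tensors (sym_L n)"
    "virtual_proj m0 m1 n (monomial (symbols m0 m1 n) w) = cls (sym_L n) x"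
    "y \<in> Irr m0 m1 n"
    "cls (symbols m0 m1 n) (word w) = cls (symbols m0 m1 n) x \<oplus>\<^bsub>UEA (symbols m0 m1 n)\<^esub> y"
proof -
  let ?S = "symbols m0 m1 n" and ?L = "sym_L n"
  let ?P = "\<lambda>u. u \<in> carrier (UEA ?L) \<and>
      (\<exists>y\<in>Irr m0 m1 n. monomial ?S w = inclusion m0 m1 n u \<oplus>\<^bsub>UEA ?S\<^esub> y)"
  have LS: "tensors ?L \<subseteq> tensors ?S" by (rule tensors_mono) (simp add: symbols_eq)
  interpret J: virtual_left_ideal m0 m1 n "{x \<in> tensors ?S. cls ?S x \<in> Irr m0 m1 n}"
    by (rule virtual_left_ideal_Irr)
  obtain x where x: "x \<in> tensors ?L" "word w - x \<in> tensors ?S" "cls ?S (word w - x) \<in> Irr m0 m1 n"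
    using J.word_zero_weight[OF assms] by auto
  have "cls ?S (word w) = cls ?S x \<oplus>\<^bsub>UEA ?S\<^esub> cls ?S (word w - x)"
    using x LS by (subst cls_add[symmetric]) auto
  then have "?P (cls ?L x)"
    using x assms(1) by (auto simp: cls_carrier inclusion_cls monomial_eq_cls)
  \<comment> \<open>From here on only the defining property of the chosen element is available; its
    representative \<open>z\<close>, not the \<open>x\<close> constructed above, is what the lemma
    returns.\<close>
  then have P: "?P (virtual_proj m0 m1 n (monomial ?S w))"
    unfolding virtual_proj_def by (rule someI)
  then obtain z where z: "z \<in> tensors ?L" "virtual_proj m0 m1 n (monomial ?S w) = cls ?L z"
    by (auto elim: carrier_UEA_E)
  with P that show ?thesis
    using assms(1) by (auto simp: inclusion_cls monomial_eq_cls)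
qed

lemma (in virtual_vacuum) virtual_proj_act:
  assumes w: "set w \<subseteq> S \<times> S" and "y \<in> Irr m0 m1 n" and x: "x \<in> tensors (sym_L n)"
    and eq: "cls S (word w) = cls S x \<oplus>\<^bsub>UEA S\<^esub> y"
  shows "act x v = word_act E w v"
proof -
  obtain z where z: "z \<in> tensors S" "y = cls S z" "act z v = 0"
    using Irr_annihilates[OF assms(2)] .
  have xS: "x \<in> tensors S" using x tensors_mono[of "sym_L n" S] by (auto simp: symbols_eq)
  have "cls S (word w) = cls S (x + z)"
    using eq z xS by (simp add: cls_add)
  then have "word w - (x + z) \<in> enveloping_ideal S"
    using w xS z by (subst cls_eq_iff[symmetric]) auto
  from act_enveloping_ideal[OF this, of v] show ?thesis
    by (simp add: act_diff act_add z)
qed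

section \<open>The action on a highest weight vector\<close>

definition down_word :: "nat \<Rightarrow> symbol \<Rightarrow> (nat \<Rightarrow> nat) \<Rightarrow> nat \<Rightarrow> letter list" where
  "down_word n \<beta> h c = concat (map (\<lambda>i. replicate (h i) (\<beta>, Proper i)) [c..<Suc n])"

definition up_word :: "nat \<Rightarrow> symbol \<Rightarrow> (nat \<Rightarrow> nat) \<Rightarrow> nat \<Rightarrow> letter list" where
  "up_word n \<beta> h c = concat (map (\<lambda>i. replicate (h i) (Proper i, \<beta>)) (rev [c..<Suc n]))"

lemma I_word_eq: "I_word n \<beta> h = up_word n \<beta> h 1 @ down_word n \<beta> h 1"
  by (simp add: I_word_def up_word_def down_word_def)

lemma down_up_word_empty [simp]:
  "down_word n \<beta> h (Suc n) = []" "up_word n \<beta> h (Suc n) = []"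
  by (simp_all add: down_word_def up_word_def)

text \<open>The block of column c is enclosed by the up and down words of the later columns, so it
  acts on a vector produced by those columns alone.\<close>

lemma down_up_word_column:
  assumes "c \<le> n"
  shows "down_word n \<beta> h c = replicate (h c) (\<beta>, Proper c) @ down_word n \<beta> h (Suc c)"
    and "up_word n \<beta> h c = up_word n \<beta> h (Suc c) @ replicate (h c) (Proper c, \<beta>)"
proof -
  have "[c..<Suc n] = c # [Suc c..<Suc n]"
    using assms by (simp add: upt_conv_Cons)
  then show "down_word n \<beta> h c = replicate (h c) (\<beta>, Proper c) @ down_word n \<beta> h (Suc c)"
    and "up_word n \<beta> h c = up_word n \<beta> h (Suc c) @ replicate (h c) (Proper c, \<beta>)"
    by (simp_all add: down_word_def up_word_def del: upt_Suc)
qed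

lemma set_down_word: "set (down_word n \<beta> h c) \<subseteq> {\<beta>} \<times> Proper ` {c..n}"
  and set_up_word: "set (up_word n \<beta> h c) \<subseteq> Proper ` {c..n} \<times> {\<beta>}"
  by (auto simp: down_word_def up_word_def simp del: upt_Suc split: if_splits)

lemma length_down_word: "length (down_word n \<beta> h c) = (\<Sum>j=c..n. h j)"
  by (simp add: down_word_def length_concat comp_def interv_sum_list_conv_sum_set_nat
      atLeastLessThanSuc_atLeastAtMost del: upt_Suc)

lemma weight_replicate: "weight (replicate m l) \<gamma> = int m * letter_weight l \<gamma>"
  by (simp add: weight_def sum_list_replicate)

lemma weight_I_word: "weight (I_word n \<beta> h) = 0"
proof (rule ext)
  fix \<gamma>
  have "weight (up_word n \<beta> h c) \<gamma> + weight (down_word n \<beta> h c) \<gamma> = 0" if "c \<le> Suc n" for c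
    using that
  proof (induction rule: inc_induct)
    case (step c)
    have "letter_weight (Proper c, \<beta>) \<gamma> = - letter_weight (\<beta>, Proper c) \<gamma>"
      by (simp add: letter_weight_def)
    then show ?case
      using step by (simp add: down_up_word_column weight_replicate)
  qed simp
  from this[of 1] show "weight (I_word n \<beta> h) \<gamma> = 0 \<gamma>"
    by (simp add: I_word_eq)
qed

lemma set_I_word:
  assumes "\<beta> \<in> sym_A1 m1"
  shows "set (I_word n \<beta> h) \<subseteq> symbols m0 m1 n \<times> symbols m0 m1 n"
  using set_up_word[of n \<beta> h 1] set_down_word[of n \<beta> h 1] assms
  by (fastforce simp: I_word_eq symbols_def sym_L_def)

locale virtual_highest_weight = virtual_vacuum +
  fixes l :: "nat \<Rightarrow> nat" and \<beta> :: symbol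
  assumes raising: "1 \<le> i \<Longrightarrow> i < j \<Longrightarrow> j \<le> n \<Longrightarrow> E (Proper i) (Proper j) v = 0"
    and proper_weight: "1 \<le> i \<Longrightarrow> i \<le> n \<Longrightarrow> E (Proper i) (Proper i) v = smul (of_nat (l i)) v"
    and \<beta>: "\<beta> \<in> sym_A1 m1"
begin

lemma \<beta>_simps [simp]: "parity \<beta> = 1" "\<beta> \<noteq> Proper i" "Proper i \<noteq> \<beta>" "\<beta> \<in> S" "\<beta> \<in> virtuals m0 m1"
  using \<beta> by (auto simp: sym_A1_def symbols_def virtuals_def)

lemma Proper_S: "1 \<le> i \<Longrightarrow> i \<le> n \<Longrightarrow> Proper i \<in> S"
  by (auto simp: symbols_def sym_L_def)

text \<open>For odd symbols all $e_{a,b}$ are even, and the superbracket becomes the ordinary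
  commutator.\<close>

lemma E_commute:
  assumes "a \<in> S" "b \<in> S" "c \<in> S" "d \<in> S" "parity a = 1" "parity b = 1" "parity c = 1" "parity d = 1"
  shows "E a b (E c d x) =
    E c d (E a b x) + (if b = c then E a d x else 0) - (if a = d then E c b x else 0)"
  using E_rel[of a b c d x] assms by (simp add: sgn_sym_def algebra_simps)

text \<open>These are the inputs of the $sl_2$-identity for column c. Proved jointly because the
  last claim uses the first: moving $e_{i,\<beta>}$ past $e_{\<beta>,k}$ leaves $e_{i,k}$ with i <
  k, which still kills the vector.\<close>

lemma raised_vacuum:
  assumes "set w \<subseteq> {\<beta>} \<times> Proper ` {Suc c..n}" "1 \<le> i" "i \<le> c" "c \<le> n"
  shows "\<And>j. i < j \<Longrightarrow> j \<le> n \<Longrightarrow> E (Proper i) (Proper j) (word_act E w v) = 0" (is "\<And>j. _ \<Longrightarrow> _ \<Longrightarrow> ?A j")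
    and "E (Proper i) (Proper i) (word_act E w v) = smul (of_nat (l i)) (word_act E w v)" (is ?B)
    and "E \<beta> \<beta> (word_act E w v) = smul (of_nat (length w)) (word_act E w v)" (is ?C)
    and "E (Proper i) \<beta> (word_act E w v) = 0" (is ?D)
proof -
  have "(\<forall>j. i < j \<longrightarrow> j \<le> n \<longrightarrow> ?A j) \<and> ?B \<and> ?C \<and> ?D"
    using assms(1)
  proof (induction w)
    case Nil
    then show ?case
      using assms raising proper_weight vacuum Proper_S by simp
  next
    case (Cons p w)
    obtain k where k: "p = (\<beta>, Proper k)" "Suc c \<le> k" "k \<le> n" using Cons.prems by auto
    let ?x = "word_act E w v"
    have IHs: "\<And>j. i < j \<Longrightarrow> j \<le> n \<Longrightarrow> E (Proper i) (Proper j) ?x = 0"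
      "E (Proper i) (Proper i) ?x = smul (of_nat (l i)) ?x"
      "E \<beta> \<beta> ?x = smul (of_nat (length w)) ?x"
      "E (Proper i) \<beta> ?x = 0"
      using Cons by auto
    have S: "Proper i \<in> S" "Proper k \<in> S" using assms k by (auto intro: Proper_S)
    have ik: "i < k" using assms k by simp
    have "E (Proper i) (Proper j) (E \<beta> (Proper k) ?x) = 0" if "i < j" "j \<le> n" for j
      using IHs(1)[OF that] that S Proper_S[of j] assms ik by (simp add: E_commute E_zero)
    moreover have "E (Proper i) (Proper i) (E \<beta> (Proper k) ?x) = smul (of_nat (l i)) (E \<beta> (Proper k) ?x)"
      using IHs(2) S ik by (simp add: E_commute E_scale)
    moreover have "E \<beta> \<beta> (E \<beta> (Proper k) ?x) = smul (of_nat (Suc (length w))) (E \<beta> (Proper k) ?x)"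
      using IHs(3) S by (simp add: E_commute E_scale scale_left_distrib add.commute)
    moreover have "E (Proper i) \<beta> (E \<beta> (Proper k) ?x) = 0"
      using IHs(1)[OF ik k(3)] IHs(4) S ik by (simp add: E_commute E_zero)
    ultimately show ?case by (simp add: k(1))
  qed
  then show "\<And>j. i < j \<Longrightarrow> j \<le> n \<Longrightarrow> ?A j" ?B ?C ?D by auto
qed

text \<open>
  \<^term>\<open>E (Proper c) \<beta>\<close> and \<^term>\<open>E \<beta> (Proper c)\<close> generate a copy of $sl_2$ with
  $H = e_{c,c} - e_{\beta,\beta}$.
\<close>

lemma sl2_lowering:
  assumes c: "1 \<le> c" "c \<le> n" and "E (Proper c) \<beta> x = 0"
    and "E (Proper c) (Proper c) x = smul p x" "E \<beta> \<beta> x = smul q x"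
  defines "f \<equiv> \<lambda>h. word_act E (replicate h (\<beta>, Proper c)) x"
  shows "E (Proper c) (Proper c) (f h) = smul (p - of_nat h) (f h)" (is "?A h")
    and "E \<beta> \<beta> (f h) = smul (q + of_nat h) (f h)" (is "?B h")
    and "E (Proper c) \<beta> (f (Suc h)) = smul (of_nat (Suc h) * (p - q - of_nat h)) (f h)" (is "?C h")
proof -
  note S = Proper_S[OF c]
  have f_Suc: "f (Suc h) = E \<beta> (Proper c) (f h)" for h by (simp add: f_def)
  have f_0: "f 0 = x" by (simp add: f_def)
  show A: "?A h" for h
  proof (induction h)
    case (Suc h)
    have "E (Proper c) (Proper c) (f (Suc h)) = smul (p - of_nat h) (f (Suc h)) - smul 1 (f (Suc h))"
      using S Suc by (simp add: f_Suc E_commute E_scale)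
    also have "\<dots> = smul (p - of_nat (Suc h)) (f (Suc h))"
      unfolding scale_left_diff_distrib[symmetric] by (rule arg_cong2[of _ _ _ _ smul]) simp_all
    finally show ?case .
  qed (simp add: assms f_0)
  show B: "?B h" for h
  proof (induction h)
    case (Suc h)
    have "E \<beta> \<beta> (f (Suc h)) = smul (q + of_nat h) (f (Suc h)) + smul 1 (f (Suc h))"
      using S Suc by (simp add: f_Suc E_commute E_scale)
    also have "\<dots> = smul (q + of_nat (Suc h)) (f (Suc h))"
      unfolding scale_left_distrib[symmetric] by (rule arg_cong2[of _ _ _ _ smul]) simp_all
    finally show ?case .
  qed (simp add: assms f_0)
  \<comment> \<open>With $e = e_{c,\<beta>}$ and $f = e_{\<beta>,c}$ this is $e f^{h+1} x = f e f^h
    x + H f^h x$; each f lowers the H-eigenvalue p - q by 2.\<close>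
  have comm: "E (Proper c) \<beta> (f (Suc h)) = E \<beta> (Proper c) (E (Proper c) \<beta> (f h)) +
      smul (p - q - 2 * of_nat h) (f h)" for h
  proof -
    have "E (Proper c) \<beta> (f (Suc h)) = E \<beta> (Proper c) (E (Proper c) \<beta> (f h)) +
        (smul (p - of_nat h) (f h) - smul (q + of_nat h) (f h))"
      using E_commute[of "Proper c" \<beta> \<beta> "Proper c" "f h"] S
      unfolding f_Suc A[symmetric] B[symmetric] by (simp add: add_diff_eq)
    also have "smul (p - of_nat h) (f h) - smul (q + of_nat h) (f h) = smul (p - q - 2 * of_nat h) (f h)"
      unfolding scale_left_diff_distrib[symmetric] by (rule arg_cong2[of _ _ _ _ smul]) simp_all
    finally show ?thesis .
  qed
  show "?C h"
  proof (induction h)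
    case 0
    then show ?case using comm[of 0] S by (simp add: f_0 assms E_zero)
  next
    case (Suc h)
    have "E (Proper c) \<beta> (f (Suc (Suc h))) =
        smul (of_nat (Suc h) * (p - q - of_nat h)) (f (Suc h)) +
        smul (p - q - 2 * of_nat (Suc h)) (f (Suc h))"
      unfolding comm[of "Suc h"] Suc using S by (simp add: E_scale f_Suc)
    \<comment> \<open>With r = p - q: (h+1)(r - h) + r - 2(h+1) = (h+2)(r - h - 1).\<close>
    also have "\<dots> = smul (of_nat (Suc (Suc h)) * (p - q - of_nat (Suc h))) (f (Suc h))"
      unfolding scale_left_distrib[symmetric] by (rule arg_cong2[of _ _ _ _ smul]) (simp_all add: algebra_simps)
    finally show ?case .
  qed
qed

lemma sl2_raising_lowering:
  assumes c: "1 \<le> c" "c \<le> n" and x: "E (Proper c) \<beta> x = 0"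
    "E (Proper c) (Proper c) x = smul (of_nat p) x" "E \<beta> \<beta> x = smul (of_nat q) x"
  shows "word_act E (replicate h (Proper c, \<beta>) @ replicate h (\<beta>, Proper c)) x =
    smul (of_int (fact h * ffall (int p - int q) h)) x"
proof (induction h)
  case (Suc h)
  let ?e = "word_act E (replicate h (Proper c, \<beta>))"
  have e: "set (replicate h (Proper c, \<beta>)) \<subseteq> S \<times> S" using Proper_S[OF c] by auto
  have "word_act E (replicate (Suc h) (Proper c, \<beta>) @ replicate (Suc h) (\<beta>, Proper c)) x =
      ?e (E (Proper c) \<beta> (word_act E (replicate (Suc h) (\<beta>, Proper c)) x))"
    \<comment> \<open>Isolates the innermost raising operator, which meets the whole block of
      lowering operators.\<close>
    unfolding replicate_Suc replicate_append_same[of h "(Proper c, \<beta>)", symmetric] by simp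
  also have "\<dots> = smul (of_nat (Suc h) * (of_nat p - of_nat q - of_nat h))
      (word_act E (replicate h (Proper c, \<beta>) @ replicate h (\<beta>, Proper c)) x)"
    unfolding sl2_lowering(3)[OF c x] word_act_scale[OF e] by simp
  also have "\<dots> = smul (of_int (fact (Suc h) * ffall (int p - int q) (Suc h))) x"
    unfolding Suc scale_scale
    by (rule arg_cong2[of _ _ _ _ smul]) (simp_all add: ffall_Suc mult_ac)
  finally show ?case .
qed simp

lemma up_down_act:
  assumes "1 \<le> c" "c \<le> Suc n"
  shows "word_act E (up_word n \<beta> h c @ down_word n \<beta> h c) v =
    smul (of_int ((\<Prod>i=c..n. fact (h i)) * comp_prod (\<lambda>i. int (l i)) n c h)) v"
  using assms(2,1)
proof (induction rule: inc_induct)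
  case base
  then show ?case by (simp add: comp_prod_def)
next
  case (step c)
  then have c: "1 \<le> c" "c \<le> n" by auto
  let ?x = "word_act E (down_word n \<beta> h (Suc c)) v"
  let ?r = "fact (h c) * ffall (int (l c) - int (\<Sum>j=Suc c..n. h j)) (h c)"
  \<comment> \<open>The $e_{\<beta>,\<beta>}$-eigenvalue is the length of the later down word, that
    is $h_{c+1} + ... + h_n$; this is the shift in the falling factorial.\<close>
  note x = raised_vacuum[OF set_down_word[of n \<beta> h "Suc c"] c(1) order_refl c(2)]
  have up: "set (up_word n \<beta> h (Suc c)) \<subseteq> S \<times> S"
    using set_up_word[of n \<beta> h "Suc c"] Proper_S by fastforce
  have "word_act E (up_word n \<beta> h c @ down_word n \<beta> h c) v =
      word_act E (up_word n \<beta> h (Suc c))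
        (word_act E (replicate (h c) (Proper c, \<beta>) @ replicate (h c) (\<beta>, Proper c)) ?x)"
    using c by (simp add: down_up_word_column)
  also have "\<dots> = smul (of_int ?r) (word_act E (up_word n \<beta> h (Suc c) @ down_word n \<beta> h (Suc c)) v)"
    unfolding sl2_raising_lowering[OF c x(4,2,3)] word_act_scale[OF up]
    by (simp add: length_down_word)
  also have "\<dots> = smul (of_int (?r * ((\<Prod>i=Suc c..n. fact (h i)) * comp_prod (\<lambda>i. int (l i)) n (Suc c) h))) v"
    using step by simp
  also have "?r * ((\<Prod>i=Suc c..n. fact (h i)) * comp_prod (\<lambda>i. int (l i)) n (Suc c) h) =
      (\<Prod>i=c..n. fact (h i)) * comp_prod (\<lambda>i. int (l i)) n c h"
    unfolding comp_prod_def prod.atLeast_Suc_atMost[OF c(2)] by (simp add: algebra_simps)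
  finally show ?case .
qed

lemma I_word_act:
  "word_act E (I_word n \<beta> h) v =
    smul (of_int ((\<Prod>i=1..n. fact (h i)) * comp_prod (\<lambda>i. int (l i)) n 1 h)) v"
  unfolding I_word_eq by (rule up_down_act) auto

end

section \<open>Transfer between highest weight vectors\<close>

text \<open>Independence of eigenvectors for different eigenvalues, in a form that allows repeated
  shifts \<open>m b\<close> and zero summands.\<close>

lemma (in vector_space) eigenvector_eq_sum_imp_zero:
  fixes H :: "'b \<Rightarrow> 'b" and m :: "'c \<Rightarrow> 'a"
  assumes add: "\<And>x y. H (x + y) = H x + H y" and scale: "\<And>c x. H (scale c x) = scale c (H x)"
    and "finite t" "H v = scale a v"
    and "\<And>b. b \<in> t \<Longrightarrow> m b \<noteq> 0 \<and> H (f b) = scale (a + m b) (f b)"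
    and "v = (\<Sum>b\<in>t. f b)"
  shows "v = 0"
  using assms(3-)
proof (induction t arbitrary: v f rule: finite_induct)
  case (insert b t)
  have H_sum: "H (\<Sum>i\<in>A. g i) = (\<Sum>i\<in>A. H (g i))" for A :: "'c set" and g
    using scale[of 0 0] by (induction A rule: infinite_finite_induct) (auto simp: add)
  have eig: "m i \<noteq> 0" "H (f i) = scale (a + m i) (f i)" if "i \<in> insert b t" for i
    using insert.prems(2)[OF that] by auto
  have v: "v = f b + (\<Sum>i\<in>t. f i)" using insert.hyps insert.prems(3) by simp
  have "scale a v = H v" using insert.prems(1) by (rule sym)
  also have "H v = (\<Sum>i\<in>insert b t. H (f i))"
    by (subst insert.prems(3)) (rule H_sum)
  also have "\<dots> = (\<Sum>i\<in>insert b t. scale (a + m i) (f i))"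
    using eig(2) by (intro sum.cong) auto
  finally have "scale a v = scale (a + m b) (f b) + (\<Sum>i\<in>t. scale (a + m i) (f i))"
    using insert.hyps by simp
  moreover have "scale (a + m b) (f b) = scale (a + m b) v - (\<Sum>i\<in>t. scale (a + m b) (f i))"
    unfolding v by (simp add: scale_right_distrib scale_sum_right)
  ultimately have "scale a v - scale (a + m b) v =
      (\<Sum>i\<in>t. scale (a + m i) (f i) - scale (a + m b) (f i))"
    by (simp add: sum_subtractf)
  also have "scale a v - scale (a + m b) v = scale (- m b) v"
    unfolding scale_left_diff_distrib[symmetric] by simp
  also have "(\<Sum>i\<in>t. scale (a + m i) (f i) - scale (a + m b) (f i)) = (\<Sum>i\<in>t. scale (m i - m b) (f i))"
    unfolding scale_left_diff_distrib[symmetric] by simp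
  \<comment> \<open>Applying H - (a + m b) removes the summand b, multiplies v by - m b, and leaves
    rescaled eigenvectors with unchanged eigenvalues.\<close>
  finally have *: "scale (- m b) v = (\<Sum>i\<in>t. scale (m i - m b) (f i))" .
  have "scale (- m b) v = 0"
  proof (rule insert.IH[OF _ _ *])
    show "H (scale (- m b) v) = scale a (scale (- m b) v)"
      using insert.prems(1) by (simp only: scale scale_left_commute)
    show "m i \<noteq> 0 \<and> H (scale (m i - m b) (f i)) = scale (a + m i) (scale (m i - m b) (f i))"
      if "i \<in> t" for i
      using eig[OF insertI2[OF that]] by (simp only: scale scale_left_commute) simp
  qed
  then show ?case using eig(1)[of b] by simp
qed simp

lemma word_act_cong:
  assumes "\<And>a b. a \<in> S \<Longrightarrow> b \<in> S \<Longrightarrow> E a b = E' a b" "set w \<subseteq> S \<times> S"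
  shows "word_act E w v = word_act E' w v"
  using assms(2) by (induction w) (auto simp: assms(1))

lemma tact_cong:
  assumes "\<And>a b. a \<in> S \<Longrightarrow> b \<in> S \<Longrightarrow> E a b = E' a b" "x \<in> tensors S"
  shows "tact smul E x v = tact smul E' x v"
  unfolding tact_def
proof (intro sum.cong refl arg_cong2[of _ _ _ _ smul])
  fix w assume "w \<in> Poly_Mapping.keys x"
  then have "set w \<subseteq> S \<times> S" using assms(2) by (auto simp: tensors_def)
  with assms(1) show "word_act E w v = word_act E' w v" by (rule word_act_cong)
qed

section \<open>Grading of the module generated by a highest weight vector\<close>

context gl_module
begin

abbreviation gl_act :: "tensor \<Rightarrow> 'v \<Rightarrow> 'v" where
  "gl_act \<equiv> tact smul (\<lambda>a b. \<rho> (idx a) (idx b))"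

text \<open>The coefficients i make $\<rho>_{i,j}$ shift the eigenvalue by i - j. Lowering operators
  have j < i, so this one operator separates v from all that is obtained by lowering it.\<close>

definition grading :: "'v \<Rightarrow> 'v" where
  "grading x = (\<Sum>i=1..n. smul (of_nat i) (\<rho> i i x))"

lemma grading_add: "grading (x + y) = grading x + grading y"
  by (simp add: grading_def rho_add scale_right_distrib sum.distrib)

lemma grading_scale: "grading (smul c x) = smul c (grading x)"
  unfolding grading_def scale_sum_right
  by (intro sum.cong refl) (simp add: rho_scale mult.commute)

lemma rho_zero: "i \<in> {1..n} \<Longrightarrow> j \<in> {1..n} \<Longrightarrow> \<rho> i j 0 = 0"
  using rho_scale[of i j 0 0] by simp

lemma rho_sum: "i \<in> {1..n} \<Longrightarrow> j \<in> {1..n} \<Longrightarrow> \<rho> i j (\<Sum>k\<in>A. f k) = (\<Sum>k\<in>A. \<rho> i j (f k))"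
  by (induction A rule: infinite_finite_induct) (auto simp: rho_add rho_zero)

lemma grading_rho:
  assumes "i \<in> {1..n}" "j \<in> {1..n}"
  shows "grading (\<rho> i j x) = \<rho> i j (grading x) + smul (of_nat i - of_nat j) (\<rho> i j x)"
proof -
  have "grading (\<rho> i j x) = (\<Sum>k=1..n. smul (of_nat k) (\<rho> i j (\<rho> k k x)) +
      ((if k = i then smul (of_nat k) (\<rho> k j x) else 0) - (if k = j then smul (of_nat k) (\<rho> i k x) else 0)))"
    unfolding grading_def
  proof (intro sum.cong refl)
    fix k assume k: "k \<in> {1..n}"
    have "\<rho> k k (\<rho> i j x) = \<rho> i j (\<rho> k k x) +
        ((if k = i then \<rho> k j x else 0) - (if k = j then \<rho> i k x else 0))"
      using rho_bracket[OF k k assms, of x] by (simp add: diff_eq_eq add.commute)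
    then show "smul (of_nat k) (\<rho> k k (\<rho> i j x)) = smul (of_nat k) (\<rho> i j (\<rho> k k x)) +
      ((if k = i then smul (of_nat k) (\<rho> k j x) else 0) - (if k = j then smul (of_nat k) (\<rho> i k x) else 0))"
      by (simp add: scale_right_distrib scale_right_diff_distrib)
  qed
  also have "\<dots> = \<rho> i j (grading x) + (smul (of_nat i) (\<rho> i j x) - smul (of_nat j) (\<rho> i j x))"
    using assms by (simp add: sum.distrib sum_subtractf grading_def rho_sum rho_scale sum.delta)
  finally show ?thesis by (simp add: scale_left_diff_distrib)
qed

inductive_set lowered :: "'v \<Rightarrow> 'v set" for v where
  vacuum: "v \<in> lowered v"
| lower: "x \<in> lowered v \<Longrightarrow> i \<in> {1..n} \<Longrightarrow> j \<in> {1..n} \<Longrightarrow> j < i \<Longrightarrow> \<rho> i j x \<in> lowered v"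

lemma rho_span:
  assumes "i \<in> {1..n}" "j \<in> {1..n}" "\<And>x. x \<in> A \<Longrightarrow> \<rho> i j x \<in> span B" "x \<in> span A"
  shows "\<rho> i j x \<in> span B"
  using assms(4)
proof (induction rule: span_induct_alt)
  case base
  then show ?case using rho_zero assms by (simp add: span_zero)
next
  case (step c x y)
  then show ?case
    using assms by (simp add: rho_add rho_scale span_add span_scale)
qed

text \<open>Commuting past the outermost lowering operator leaves single operators on the shorter
  product, of any type; hence the induction over all i and j.\<close>

lemma lowered_rho:
  assumes "highest_weight_vector n smul \<rho> wt v" "x \<in> lowered v" "i \<in> {1..n}" "j \<in> {1..n}"
  shows "\<rho> i j x \<in> span (lowered v)"
  using assms(2-)
proof (induction arbitrary: i j)
  case vacuum
  consider "i < j" | "i = j" | "j < i" by linarith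
  then show ?case
  proof cases
    case 1
    then show ?thesis using assms(1) vacuum by (simp add: highest_weight_vector_def span_zero)
  next
    case 2
    then show ?thesis
      using assms(1) vacuum span_scale[OF span_base[OF lowered.vacuum[of v]], of "wt i"]
      by (simp add: highest_weight_vector_def)
  next
    case 3
    then show ?thesis using vacuum by (intro span_base lowered.intros)
  qed
next
  case (lower x k l)
  have "\<rho> i j (\<rho> k l x) = \<rho> k l (\<rho> i j x) +
      ((if j = k then \<rho> i l x else 0) - (if i = l then \<rho> k j x else 0))"
    using rho_bracket[OF lower.prems lower.hyps(2,3), of x] by (simp add: diff_eq_eq add.commute)
  moreover have "\<rho> k l y \<in> span (lowered v)" if "y \<in> lowered v" for y
    using lowered.lower[OF that lower.hyps(2-4)] by (rule span_base)
  then have "\<rho> k l (\<rho> i j x) \<in> span (lowered v)"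
    by (rule rho_span[OF lower.hyps(2,3) _ lower.IH[OF lower.prems]])
  ultimately show ?case
    using lower by (auto intro!: span_add span_diff span_zero)
qed

lemma gl_act_lowered:
  assumes "highest_weight_vector n smul \<rho> wt v" "x \<in> tensors (sym_L n)"
  shows "gl_act x v \<in> span (lowered v)"
proof -
  interpret R: super_rep smul "sym_L n" "\<lambda>a b. \<rho> (idx a) (idx b)" by (rule super_rep)
  have word: "word_act (\<lambda>a b. \<rho> (idx a) (idx b)) w v \<in> span (lowered v)"
    if "set w \<subseteq> sym_L n \<times> sym_L n" for w
    using that
  proof (induction w)
    case Nil
    then show ?case by (auto intro: span_base lowered.vacuum)
  next
    case (Cons p w)
    then obtain i j where p: "p = (Proper i, Proper j)" "i \<in> {1..n}" "j \<in> {1..n}"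
      by (auto simp: sym_L_def)
    show ?case
      using rho_span[OF p(2,3) lowered_rho[OF assms(1) _ p(2,3)]] Cons by (simp add: p(1))
  qed
  from assms(2) show ?thesis
    by (induction rule: tensor_induct)
      (auto simp: R.act_single R.act_add span_zero intro!: span_add span_scale word)
qed

lemma span_lowered_decompose:
  assumes hw: "highest_weight_vector n smul \<rho> wt v" and x: "x \<in> span (lowered v)"
  defines "a \<equiv> \<Sum>i=1..n. of_nat i * wt i"
  obtains c :: complex and t :: "'v set" and f and m :: "'v \<Rightarrow> complex" where
    "finite t" "x = smul c v + (\<Sum>b\<in>t. f b)"
    "\<forall>b\<in>t. m b \<noteq> 0 \<and> grading (f b) = smul (a + m b) (f b)"
proof -
  have v: "grading v = smul a v"
    using hw by (simp add: highest_weight_vector_def grading_def a_def scale_sum_left)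
  have "\<exists>m::nat. (m = 0 \<longrightarrow> x = v) \<and> grading x = smul (a + of_nat m) x" if "x \<in> lowered v" for x
    using that
  proof induction
    case vacuum
    then show ?case using v by (intro exI[of _ 0]) simp
  next
    case (lower x i j)
    then obtain m :: nat where m: "grading x = smul (a + of_nat m) x" by auto
    have "grading (\<rho> i j x) = smul (a + of_nat m) (\<rho> i j x) + smul (of_nat i - of_nat j) (\<rho> i j x)"
      using lower by (simp add: grading_rho m rho_scale)
    also have "\<dots> = smul (a + of_nat (m + (i - j))) (\<rho> i j x)"
      unfolding scale_left_distrib[symmetric]
      by (rule arg_cong2[of _ _ _ _ smul]) (use lower in \<open>simp_all add: of_nat_diff\<close>)
    finally show ?case using lower by (intro exI[of _ "m + (i - j)"]) auto
  qed
  then obtain m :: "'v \<Rightarrow> nat" where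
    m: "\<And>x. x \<in> lowered v \<Longrightarrow> (m x = 0 \<longrightarrow> x = v) \<and> grading x = smul (a + of_nat (m x)) x"
    by metis
  obtain t r where t: "finite t" "t \<subseteq> lowered v" "x = (\<Sum>b\<in>t. smul (r b) b)"
    using x by (auto simp: span_explicit)
  \<comment> \<open>Every spanning vector other than v has a positive shift, so v is the only one in
    its degree.\<close>
  show ?thesis
  proof (rule that[of "t - {v}" "if v \<in> t then r v else 0" "\<lambda>b. smul (r b) b" "\<lambda>b. of_nat (m b)"])
    show "finite (t - {v})" using t by simp
    show "x = smul (if v \<in> t then r v else 0) v + (\<Sum>b\<in>t - {v}. smul (r b) b)"
      using t by (simp add: sum.remove)
    show "\<forall>b\<in>t - {v}. of_nat (m b) \<noteq> (0::complex) \<and>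
        grading (smul (r b) b) = smul (a + of_nat (m b)) (smul (r b) b)"
    proof
      fix b assume "b \<in> t - {v}"
      then have "b \<in> lowered v" "b \<noteq> v" using t by auto
      then show "of_nat (m b) \<noteq> (0::complex) \<and>
          grading (smul (r b) b) = smul (a + of_nat (m b)) (smul (r b) b)"
        using m[of b] by (auto simp: grading_scale mult.commute)
    qed
  qed
qed

end

text \<open>
  An irreducible module is a quotient of every cyclic module generated by a highest weight vector
  of the same weight. The two vectors generate a submodule of the product in which the common
  weight occurs only once, so it cannot contain a vector of the form $(v, 0)$.
\<close>

lemma annihilator_transfer:
  fixes smul :: "complex \<Rightarrow> 'v::ab_group_add \<Rightarrow> 'v" and smul' :: "complex \<Rightarrow> 'w::ab_group_add \<Rightarrow> 'w"
  assumes "irreducible_gl_module n smul \<rho>" and "gl_module n smul' \<rho>'"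
    and hw: "highest_weight_vector n smul \<rho> wt v" and hw': "highest_weight_vector n smul' \<rho>' wt v'"
    and x: "x \<in> tensors (sym_L n)" "tact smul' (\<lambda>a b. \<rho>' (idx a) (idx b)) x v' = 0"
  shows "tact smul (\<lambda>a b. \<rho> (idx a) (idx b)) x v = 0"
proof -
  interpret V: irreducible_gl_module n smul \<rho> by fact
  interpret W: gl_module n smul' \<rho>' by fact
  interpret RV: super_rep smul "sym_L n" "\<lambda>a b. \<rho> (idx a) (idx b)" by (rule V.super_rep)
  interpret RW: super_rep smul' "sym_L n" "\<lambda>a b. \<rho>' (idx a) (idx b)" by (rule W.super_rep)
  let ?smul = "\<lambda>c p. (smul c (fst p), smul' c (snd p))"
  let ?\<rho> = "\<lambda>i j p. (\<rho> i j (fst p), \<rho>' i j (snd p))"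
  interpret P: vector_space ?smul
    by unfold_locales (auto simp: V.scale_right_distrib V.scale_left_distrib
        W.scale_right_distrib W.scale_left_distrib)
  interpret P: gl_module n ?smul ?\<rho>
  proof (intro gl_module.intro gl_module_axioms.intro P.vector_space_axioms)
    fix i j assume ij: "i \<in> {1..n}" "j \<in> {1..n}"
    show "Vector_Spaces.linear ?smul ?smul (?\<rho> i j)"
      by unfold_locales (auto simp: V.rho_add[OF ij] W.rho_add[OF ij] V.rho_scale[OF ij] W.rho_scale[OF ij])
    fix k l p assume kl: "k \<in> {1..n}" "l \<in> {1..n}"
    show "?\<rho> i j (?\<rho> k l p) - ?\<rho> k l (?\<rho> i j p) =
        (if j = k then ?\<rho> i l p else 0) - (if i = l then ?\<rho> k j p else 0)"
      using V.rho_bracket[OF ij kl, of "fst p"] W.rho_bracket[OF ij kl, of "snd p"]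
      by (auto simp: prod_eq_iff)
  qed
  have word_P: "word_act (\<lambda>a b. ?\<rho> (idx a) (idx b)) w (u, u') =
      (word_act (\<lambda>a b. \<rho> (idx a) (idx b)) w u, word_act (\<lambda>a b. \<rho>' (idx a) (idx b)) w u')" for w u u'
    by (induction w) auto
  have act_P: "P.gl_act y (u, u') = (V.gl_act y u, W.gl_act y u')" for y u u'
    by (simp add: tact_def word_P prod_eq_iff fst_sum snd_sum)
  have hw_P: "highest_weight_vector n ?smul ?\<rho> wt (v, v')"
    using hw hw' by (auto simp: highest_weight_vector_def zero_prod_def)
  have v: "v \<noteq> 0" "v' \<noteq> 0" using hw hw' by (auto simp: highest_weight_vector_def)
  define a where "a = (\<Sum>i=1..n. of_nat i * wt i)"
  have grading_v: "V.grading v = smul a v" "W.grading v' = smul' a v'"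
    using hw hw' unfolding V.grading_def W.grading_def a_def
    by (simp_all add: highest_weight_vector_def V.scale_sum_left W.scale_sum_left)
  have grading_P: "P.grading p = (V.grading (fst p), W.grading (snd p))" for p
    by (simp add: P.grading_def V.grading_def W.grading_def prod_eq_iff fst_sum snd_sum)
  \<comment> \<open>The image in V of the annihilator of v'. It is a submodule, so by irreducibility
    it is zero unless it contains v.\<close>
  let ?K = "{V.gl_act y v | y. y \<in> tensors (sym_L n) \<and> W.gl_act y v' = 0}"
  have "v \<notin> ?K"
  proof
    assume "v \<in> ?K"
    then obtain y where y: "y \<in> tensors (sym_L n)" "V.gl_act y v = v" "W.gl_act y v' = 0"
      by auto
    have "(v, 0) \<in> P.span (P.lowered (v, v'))"
      using P.gl_act_lowered[OF hw_P y(1)] by (simp add: act_P y)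
    then obtain c and t :: "('v \<times> 'w) set" and f m where
      t: "finite t" "(v, 0) = ?smul c (v, v') + (\<Sum>b\<in>t. f b)"
      and f: "\<forall>b\<in>t. m b \<noteq> 0 \<and> P.grading (f b) = ?smul (a + m b) (f b)"
      by (rule P.span_lowered_decompose[OF hw_P, folded a_def])
    have eqs: "v = smul c v + (\<Sum>b\<in>t. fst (f b))" "0 = smul' c v' + (\<Sum>b\<in>t. snd (f b))"
      using arg_cong[OF t(2), of fst] arg_cong[OF t(2), of snd] by (simp_all add: fst_sum snd_sum)
    \<comment> \<open>Comparing parts of degree a, the first component forces c = 1 and the second
      forces c = 0.\<close>
    have "smul (1 - c) v = 0"
    proof (rule V.eigenvector_eq_sum_imp_zero[OF V.grading_add V.grading_scale t(1)])
      show "V.grading (smul (1 - c) v) = smul a (smul (1 - c) v)"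
        by (simp add: V.grading_scale grading_v mult.commute)
      show "m b \<noteq> 0 \<and> V.grading (fst (f b)) = smul (a + m b) (fst (f b))" if "b \<in> t" for b
        using f that by (simp add: grading_P)
      show "smul (1 - c) v = (\<Sum>b\<in>t. fst (f b))"
        using eqs(1) by (simp add: V.scale_left_diff_distrib diff_eq_eq add.commute)
    qed
    then have "c = 1" using v by simp
    have "smul' (- c) v' = 0"
    proof (rule W.eigenvector_eq_sum_imp_zero[OF W.grading_add W.grading_scale t(1)])
      show "W.grading (smul' (- c) v') = smul' a (smul' (- c) v')"
        by (simp only: W.grading_scale grading_v W.scale_left_commute)
      show "m b \<noteq> 0 \<and> W.grading (snd (f b)) = smul' (a + m b) (snd (f b))" if "b \<in> t" for b
        using f that by (simp add: grading_P)
      show "smul' (- c) v' = (\<Sum>b\<in>t. snd (f b))"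
        unfolding W.scale_minus_left by (rule minus_unique[OF eqs(2)[symmetric]])
    qed
    then show False using \<open>c = 1\<close> v by simp
  qed
  moreover have "?K = {0} \<or> ?K = UNIV"
  proof (rule V.irreducible)
    show "V.subspace ?K"
    proof (rule V.subspaceI)
      show "0 \<in> ?K" by (auto intro!: exI[of _ 0])
      show "u + u' \<in> ?K" if "u \<in> ?K" "u' \<in> ?K" for u u'
        using that by clarsimp (metis RV.act_add RW.act_add add_0 tensors_add)
      show "smul c u \<in> ?K" if "u \<in> ?K" for c u
        using that by clarsimp
          (metis RV.act_const RV.act_mult RW.act_const RW.act_mult W.scale_zero_right tensors_const tensors_mult)
    qed
    fix i j u assume ij: "i \<in> {1..n}" "j \<in> {1..n}" and "u \<in> ?K"
    then obtain y where y: "y \<in> tensors (sym_L n)" "u = V.gl_act y v" "W.gl_act y v' = 0" by auto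
    have g: "gen (Proper i) (Proper j) \<in> tensors (sym_L n)"
      using ij by (intro tensors_gen) (auto simp: sym_L_def)
    show "\<rho> i j u \<in> ?K"
      using y g ij
      by (auto simp: RV.act_mult RW.act_mult W.rho_zero
          intro!: exI[of _ "gen (Proper i) (Proper j) * y"] tensors_mult)
  qed
  ultimately have "?K = {0}" by blast
  then show ?thesis using x by blast
qed

section \<open>The eigenvalue\<close>

text \<open>One tensor must serve for the element itself and for its action. Modules are quantified
  over the type \<open>fock\<close>, because the property of an obtained \<open>x\<close> cannot be
  polymorphic.\<close>

lemma I_elem_representative:
  assumes "\<beta> \<in> sym_A1 m1"
  obtains x where "x \<in> tensors (sym_L n)" "I_elem m0 m1 n \<beta> k = cls (sym_L n) x"
    "\<And>(smul :: complex \<Rightarrow> fock \<Rightarrow> fock) E v l. virtual_highest_weight smul m0 m1 n E v l \<beta> \<Longrightarrow>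
      tact smul E x v =
        smul (of_int (\<Sum>h\<in>compositions n 1 k. comp_prod (\<lambda>i. int (l i)) n 1 h)) v"
proof -
  let ?S = "symbols m0 m1 n" and ?L = "sym_L n"
  let ?w = "\<lambda>h. I_word n \<beta> h" and ?A = "compositions n 1 k"
  let ?r = "\<lambda>h. \<Prod>i=1..n. fact (h i) :: complex"
  note w = set_I_word[OF assms]
  have "\<exists>x. x \<in> tensors ?L \<and> virtual_proj m0 m1 n (monomial ?S (?w h)) = cls ?L x \<and>
      (\<exists>y\<in>Irr m0 m1 n. cls ?S (word (?w h)) = cls ?S x \<oplus>\<^bsub>UEA ?S\<^esub> y)" for h
    by (rule virtual_proj_monomial[OF w[of n h m0] weight_I_word]) blast
  then obtain x where x: "\<And>h. x h \<in> tensors ?L"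
    "\<And>h. virtual_proj m0 m1 n (monomial ?S (?w h)) = cls ?L (x h)"
    "\<And>h. \<exists>y\<in>Irr m0 m1 n. cls ?S (word (?w h)) = cls ?S (x h) \<oplus>\<^bsub>UEA ?S\<^esub> y"
    by metis
  let ?x = "\<Sum>h\<in>?A. const (1 / ?r h) * x h"
  show ?thesis
  proof (rule that[of ?x])
    show "?x \<in> tensors ?L" using x by (intro tensors_sum tensors_mult) auto
    have "I_elem m0 m1 n \<beta> k = (\<Oplus>\<^bsub>UEA ?L\<^esub>h\<in>?A. cls ?L (const (1 / ?r h) * x h))"
      using x by (simp add: I_elem_def compositions_def scalar_mult_def cls_mult)
    also have "\<dots> = cls ?L ?x"
      using x by (intro cls_sum finite_compositions tensors_mult) auto
    finally show "I_elem m0 m1 n \<beta> k = cls ?L ?x" .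
    fix smul :: "complex \<Rightarrow> fock \<Rightarrow> fock" and E v l
    assume "virtual_highest_weight smul m0 m1 n E v l \<beta>"
    then interpret H: virtual_highest_weight smul m0 m1 n E v l \<beta> .
    have "H.act (x h) v = smul (of_int ((\<Prod>i=1..n. fact (h i)) * comp_prod (\<lambda>i. int (l i)) n 1 h)) v" for h
      using x(3)[of h] H.virtual_proj_act[OF w _ x(1)] H.I_word_act[of h] by metis
    \<comment> \<open>The factor 1 / h! in \<open>I_elem\<close> cancels the factorials produced by
      the $sl_2$-identity.\<close>
    then have "H.act (const (1 / ?r h) * x h) v = smul (of_int (comp_prod (\<lambda>i. int (l i)) n 1 h)) v" for h
      by (simp add: H.act_mult)
    then show "H.act ?x v = smul (of_int (\<Sum>h\<in>?A. comp_prod (\<lambda>i. int (l i)) n 1 h)) v"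
      by (simp only: H.act_sum of_int_sum H.scale_sum_left)
  qed
qed

lemma fock_gl_module: "gl_module n fscale (\<lambda>i j. fockE d (Proper i) (Proper j))"
proof (intro gl_module.intro gl_module_axioms.intro fock.vector_space_axioms)
  fix i j k l :: nat and f :: fock
  show "Vector_Spaces.linear fscale fscale (fockE d (Proper i) (Proper j))"
    by unfold_locales (auto simp: fock.E_add fock.E_scale)
  show "fockE d (Proper i) (Proper j) (fockE d (Proper k) (Proper l) f) -
      fockE d (Proper k) (Proper l) (fockE d (Proper i) (Proper j) f) =
    (if j = k then fockE d (Proper i) (Proper l) f else 0) -
      (if i = l then fockE d (Proper k) (Proper j) f else 0)"
    using fock.E_rel[of "Proper i" "Proper j" "Proper k" "Proper l" d f] by (simp add: sgn_sym_def)
qed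

lemma fock_highest_weight:
  assumes "\<And>i j. i \<le> j \<Longrightarrow> \<kappa> j \<le> \<kappa> i" "\<And>i. \<kappa> i \<le> d"
  shows "highest_weight_vector n fscale (\<lambda>i j. fockE d (Proper i) (Proper j)) (\<lambda>i. of_nat (\<kappa> i))
      (fock_state (diagram_state n \<kappa>))"
    and "\<beta> \<in> sym_A1 m1 \<Longrightarrow>
      virtual_highest_weight fscale m0 m1 n (fockE d) (fock_state (diagram_state n \<kappa>)) \<kappa> \<beta>"
proof -
  show "highest_weight_vector n fscale (\<lambda>i j. fockE d (Proper i) (Proper j)) (\<lambda>i. of_nat (\<kappa> i))
      (fock_state (diagram_state n \<kappa>))"
    using assms by (auto simp: highest_weight_vector_def fock_state_nonzero fockE_diagram_raising
        fockE_diagram_weight)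
  show "virtual_highest_weight fscale m0 m1 n (fockE d) (fock_state (diagram_state n \<kappa>)) \<kappa> \<beta>"
    if "\<beta> \<in> sym_A1 m1"
  proof unfold_locales
    show "fockE d a \<gamma> (fock_state (diagram_state n \<kappa>)) = 0" if "\<gamma> \<in> virtuals m0 m1" for a \<gamma>
      using virtuals_not_Proper[OF that] by (intro fockE_diagram_virtual) auto
  qed (use assms that in \<open>auto simp: fock.E_add fock.E_scale fock.E_rel fockE_diagram_raising
      fockE_diagram_weight\<close>)
qed

theorem theorem4p25:
  fixes n k m0 m1 :: nat
    and \<beta> :: symbol
    and \<mu> :: "nat list"
    and smul :: "complex \<Rightarrow> 'v::ab_group_add \<Rightarrow> 'v"
    and \<rho> :: "nat \<Rightarrow> nat \<Rightarrow> 'v \<Rightarrow> 'v"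
    and v :: 'v
  assumes "n \<ge> 1" and "k \<ge> 1"
    and "\<beta> \<in> sym_A1 m1"
    and "is_partition \<mu>" and "part \<mu> 1 \<le> n"
    and "irreducible_gl_module n smul \<rho>"
    and "highest_weight_vector n smul \<rho> (\<lambda>i. of_nat (conjugate \<mu> i)) v"
  shows
    "U_action smul \<rho> (I_elem m0 m1 n \<beta> k) v = smul (of_nat (hstar \<mu> k)) v
     \<and>
     int (hstar \<mu> k) =
       (\<Sum>xs\<in>{xs. length xs = k \<and> sorted xs \<and> set xs \<subseteq> {1..n}}.
          \<Prod>s=1..k. (int (conjugate \<mu> (xs ! (s - 1))) - int k + int s))
     \<and>
     (conjugate \<mu> 1 < k \<longrightarrow> U_action smul \<rho> (I_elem m0 m1 n \<beta> k) v = 0)"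
proof (intro conjI impI)
  interpret V: irreducible_gl_module n smul \<rho> by fact
  interpret RV: super_rep smul "sym_L n" "\<lambda>a b. \<rho> (idx a) (idx b)" by (rule V.super_rep)
  \<comment> \<open>The length of the partition bounds every column, so the sums in
    \<open>fockE\<close> reach all variables of the state.\<close>
  let ?\<kappa> = "conjugate \<mu>" and ?d = "length \<mu>"
  let ?v = "fock_state (diagram_state n ?\<kappa>)" and ?E = "fockE ?d"
  let ?\<rho> = "\<lambda>i j. ?E (Proper i) (Proper j)"
  interpret W: gl_module n fscale ?\<rho> by (rule fock_gl_module)
  interpret RW: super_rep fscale "sym_L n" "\<lambda>a b. ?\<rho> (idx a) (idx b)" by (rule W.super_rep)
  have fock_hw: "highest_weight_vector n fscale ?\<rho> (\<lambda>i. of_nat (?\<kappa> i)) ?v"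
    by (rule fock_highest_weight(1)[OF conjugate_antimono conjugate_le_length])
  have fock_vhw: "virtual_highest_weight fscale m0 m1 n ?E ?v ?\<kappa> \<beta>"
    by (rule fock_highest_weight(2)[OF conjugate_antimono conjugate_le_length \<open>\<beta> \<in> sym_A1 m1\<close>])
  obtain x where x: "x \<in> tensors (sym_L n)" "I_elem m0 m1 n \<beta> k = cls (sym_L n) x"
    and x_act: "tact fscale ?E x ?v =
      fscale (of_int (\<Sum>h\<in>compositions n 1 k. comp_prod (\<lambda>i. int (?\<kappa> i)) n 1 h)) ?v"
    using I_elem_representative[OF \<open>\<beta> \<in> sym_A1 m1\<close>, of n m0 k] fock_vhw
    by metis
  \<comment> \<open>The left-hand action passes each symbol through \<open>idx\<close> and
    \<open>Proper\<close>, which changes nothing on words over L.\<close>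
  have "tact fscale (\<lambda>a b. ?\<rho> (idx a) (idx b)) x ?v = tact fscale ?E x ?v"
    using x(1) by (intro tact_cong[of "sym_L n"]) (auto simp: sym_L_def)
  also have "\<dots> = fscale (of_nat (hstar \<mu> k)) ?v"
    unfolding x_act hstar_eq_comp_sum[OF \<open>part \<mu> 1 \<le> n\<close> \<open>is_partition \<mu>\<close>, symmetric] by simp
  \<comment> \<open>The eigenvalue equation is restated as annihilation by a tensor, the form that
    transfers between modules.\<close>
  finally have "tact fscale (\<lambda>a b. ?\<rho> (idx a) (idx b)) (x - const (of_nat (hstar \<mu> k))) ?v = 0"
    unfolding RW.act_diff RW.act_const by simp
  then have "tact smul (\<lambda>a b. \<rho> (idx a) (idx b)) (x - const (of_nat (hstar \<mu> k))) v = 0"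
    by (rule annihilator_transfer[OF \<open>irreducible_gl_module n smul \<rho>\<close> W.gl_module_axioms
          \<open>highest_weight_vector n smul \<rho> (\<lambda>i. of_nat (conjugate \<mu> i)) v\<close> fock_hw
          tensors_diff[OF x(1) tensors_const]])
  then show eigenvalue: "U_action smul \<rho> (I_elem m0 m1 n \<beta> k) v = smul (of_nat (hstar \<mu> k)) v"
    using x unfolding RV.act_diff RV.act_const by (simp add: V.U_action_cls)
  show "U_action smul \<rho> (I_elem m0 m1 n \<beta> k) v = 0" if "conjugate \<mu> 1 < k"
    unfolding eigenvalue using hstar_eq_0[OF that] by simp
  show "int (hstar \<mu> k) =
      (\<Sum>xs\<in>{xs. length xs = k \<and> sorted xs \<and> set xs \<subseteq> {1..n}}.
        \<Prod>s=1..k. (int (conjugate \<mu> (xs ! (s - 1))) - int k + int s))"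
    using hstar_eq_list_sum[OF \<open>part \<mu> 1 \<le> n\<close> \<open>is_partition \<mu>\<close>]
    by (simp add: list_sum_def sorted_lists_def)
qed

end
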